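(* Let $p>0$ be real. The greedy algorithm is a polynomial-time algorithm for the maximum $p$-mean set cover problem which, on every instance, outputs a cover whose value $M_p(\{a_v: v\in V\})$ is at least $\mathrm{OPT}/(p+1)^{1/p}$, where $\mathrm{OPT}$ is the optimal value. Moreover, this bound is asymptotically tight for the greedy algorithm: there are instances on which the ratio between the optimal value and the value of the greedy cover is arbitrarily close to $(p+1)^{1/p}$.
   Context: An instance of the maximum $p$-mean set cover problem consists of an $n$-element ground set $V$ and a collection $\mathcal S=\{S_1,\dots,S_k\}$ of subsets of $V$ whose union is $V$. A cover is a map $\phi:V\to\mathcal S$ with $v\in\phi(v)$ for all $v\in V$. For a cover $\phi$ and $v\in V$, let $a_v:=|\phi^{-1}(\phi(v))|$. The generalized mean is $M_p(\{a_v: v\in V\})=\left(\frac1n\sum_{v\in V}a_v^p\right)^{1/p}$. The problem asks for a cover maximizing $M_p(\{a_v : v\in V\})$. The greedy algorithm repeatedly chooses a set $S_i\in\mathcal S$ containing the maximum number of not-yet-covered elements and assigns all those uncovered elements to $S_i$, until every element is assigned. *)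

theory Defs
  imports Complex_Main "HOL-Computational_Algebra.Polynomial"
begin

section \<open>Maximum p-mean set cover\<close>

text \<open>The empty ground set is allowed; there every cover has mean \<open>0\<close>, as \<open>0 / 0 = 0\<close>.\<close>

definition set_cover_instance :: "'a set \<Rightarrow> 'a set set \<Rightarrow> bool" where
  "set_cover_instance V S \<longleftrightarrow> finite V \<and> \<Union>S = V"

text \<open>Covers, like all assignments below, are only relevant on \<open>V\<close>.\<close>

definition is_cover :: "'a set \<Rightarrow> 'a set set \<Rightarrow> ('a \<Rightarrow> 'a set) \<Rightarrow> bool" where
  "is_cover V S \<phi> \<longleftrightarrow> (\<forall>v\<in>V. \<phi> v \<in> S \<and> v \<in> \<phi> v)"

definition class_size :: "'a set \<Rightarrow> ('a \<Rightarrow> 'a set) \<Rightarrow> 'a \<Rightarrow> nat" where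
  "class_size V \<phi> v = card {w \<in> V. \<phi> w = \<phi> v}"

definition gen_mean :: "real \<Rightarrow> 'a set \<Rightarrow> ('a \<Rightarrow> real) \<Rightarrow> real" where
  "gen_mean p V a = ((1 / real (card V)) * (\<Sum>v\<in>V. a v powr p)) powr (1 / p)"

definition cover_value :: "real \<Rightarrow> 'a set \<Rightarrow> ('a \<Rightarrow> 'a set) \<Rightarrow> real" where
  "cover_value p V \<phi> = gen_mean p V (\<lambda>v. real (class_size V \<phi> v))"

text \<open>Only finitely many values occur, so the maximum is attained.\<close>

definition opt_value :: "real \<Rightarrow> 'a set \<Rightarrow> 'a set set \<Rightarrow> real" where
  "opt_value p V S = Max {cover_value p V \<phi> |\<phi>. is_cover V S \<phi>}"


section \<open>The greedy algorithm\<close>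

text \<open>
  A state consists of the set \<open>U\<close> of uncovered elements and the current assignment.
  Ties are broken arbitrarily, hence a relation.
\<close>

inductive greedy_step ::
  "'a set set \<Rightarrow> 'a set \<times> ('a \<Rightarrow> 'a set) \<Rightarrow> 'a set \<times> ('a \<Rightarrow> 'a set) \<Rightarrow> bool" for S where
  "\<lbrakk>U \<noteq> {}; A \<in> S; \<forall>B\<in>S. card (B \<inter> U) \<le> card (A \<inter> U)\<rbrakk>
   \<Longrightarrow> greedy_step S (U, \<phi>) (U - A, \<lambda>v. if v \<in> A \<inter> U then A else \<phi> v)"

text \<open>The initial assignment \<open>\<phi>\<^sub>0\<close> is arbitrary: it is overwritten on all of \<open>V\<close>.\<close>

definition greedy_cover :: "'a set \<Rightarrow> 'a set set \<Rightarrow> ('a \<Rightarrow> 'a set) \<Rightarrow> bool" where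
  "greedy_cover V S \<phi> \<longleftrightarrow> (\<exists>\<phi>\<^sub>0. (greedy_step S)\<^sup>*\<^sup>* (V, \<phi>\<^sub>0) ({}, \<phi>))"


section \<open>A machine model for polynomial time\<close>

text \<open>
  The model is the language WHILE over binary trees from N. D. Jones, \<open>Computability and
  Complexity from a Programming Perspective\<close>. Every operation inspects or builds a single
  node and costs one unit (the only test is whether a tree is a leaf; there is no unit-cost
  comparison of trees). Polynomial time in this model coincides with polynomial time on
  Turing machines.
\<close>

datatype dat = Leaf | Node dat dat

fun left :: "dat \<Rightarrow> dat" where
  "left Leaf = Leaf"
| "left (Node a b) = a"

fun right :: "dat \<Rightarrow> dat" where
  "right Leaf = Leaf"
| "right (Node a b) = b"

datatype wexp = WVar nat | WLeaf | WNode wexp wexp | WLeft wexp | WRight wexp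

type_synonym wstore = "nat \<Rightarrow> dat"

fun wval :: "wexp \<Rightarrow> wstore \<Rightarrow> dat" where
  "wval (WVar x) s = s x"
| "wval WLeaf s = Leaf"
| "wval (WNode e f) s = Node (wval e s) (wval f s)"
| "wval (WLeft e) s = left (wval e s)"
| "wval (WRight e) s = right (wval e s)"

fun wcost :: "wexp \<Rightarrow> nat" where
  "wcost (WVar x) = 1"
| "wcost WLeaf = 1"
| "wcost (WNode e f) = 1 + wcost e + wcost f"
| "wcost (WLeft e) = 1 + wcost e"
| "wcost (WRight e) = 1 + wcost e"

datatype wcom =
    WAssign nat wexp
  | WSeq wcom wcom
  | WIf wexp wcom wcom
  | WWhile wexp wcom

text \<open>\<open>wexec c s t s'\<close>: started in \<open>s\<close>, \<open>c\<close> halts after \<open>t\<close> steps in \<open>s'\<close>.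
  A test succeeds if its value is not a leaf.\<close>

inductive wexec :: "wcom \<Rightarrow> wstore \<Rightarrow> nat \<Rightarrow> wstore \<Rightarrow> bool" where
  assign: "wexec (WAssign x e) s (1 + wcost e) (s(x := wval e s))"
| seq: "\<lbrakk>wexec c s t s'; wexec d s' t' s''\<rbrakk> \<Longrightarrow> wexec (WSeq c d) s (t + t') s''"
| if_true: "\<lbrakk>wval e s \<noteq> Leaf; wexec c s t s'\<rbrakk>
    \<Longrightarrow> wexec (WIf e c d) s (1 + wcost e + t) s'"
| if_false: "\<lbrakk>wval e s = Leaf; wexec d s t s'\<rbrakk>
    \<Longrightarrow> wexec (WIf e c d) s (1 + wcost e + t) s'"
| while_true: "\<lbrakk>wval e s \<noteq> Leaf; wexec c s t s'; wexec (WWhile e c) s' t' s''\<rbrakk>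
    \<Longrightarrow> wexec (WWhile e c) s (1 + wcost e + t + t') s''"
| while_false: "wval e s = Leaf \<Longrightarrow> wexec (WWhile e c) s (1 + wcost e) s"

text \<open>Input and output are held in variable \<open>0\<close>; all other variables start out as leaves.\<close>

definition computes_in :: "wcom \<Rightarrow> dat \<Rightarrow> nat \<Rightarrow> dat \<Rightarrow> bool" where
  "computes_in c d t d' \<longleftrightarrow> (\<exists>s. wexec c ((\<lambda>_. Leaf)(0 := d)) t s \<and> s 0 = d')"


section \<open>Encoding of instances and covers\<close>

fun enc_bool :: "bool \<Rightarrow> dat" where
  "enc_bool False = Leaf"
| "enc_bool True = Node Leaf Leaf"

fun enc_list :: "('b \<Rightarrow> dat) \<Rightarrow> 'b list \<Rightarrow> dat" where
  "enc_list f [] = Leaf"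
| "enc_list f (x # xs) = Node (f x) (enc_list f xs)"

definition enc_matrix :: "bool list list \<Rightarrow> dat" where
  "enc_matrix M = enc_list (enc_list enc_bool) M"

text \<open>
  An instance with ground set \<open>{..<n}\<close> is given by its incidence matrix \<open>M\<close>, one row per
  member of the collection. A cover is given by the list \<open>R\<close> of the rows assigned to
  \<open>0, \<dots>, n - 1\<close>.
\<close>

definition row_set :: "bool list \<Rightarrow> nat set" where
  "row_set r = {i. i < length r \<and> r ! i}"

definition matrix_instance :: "nat \<Rightarrow> bool list list \<Rightarrow> bool" where
  "matrix_instance n M \<longleftrightarrow>
     (\<forall>r\<in>set M. length r = n) \<and> set_cover_instance {..<n} (row_set ` set M)"

definition greedy_output :: "nat \<Rightarrow> bool list list \<Rightarrow> bool list list \<Rightarrow> bool" where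
  "greedy_output n M R \<longleftrightarrow>
     length R = n \<and> set R \<subseteq> set M \<and>
     greedy_cover {..<n} (row_set ` set M) (\<lambda>v. row_set (R ! v))"

text \<open>The size of a tree is its number of inner nodes, here between \<open>k (n + 1)\<close> and
  \<open>k (2 n + 1)\<close> for \<open>k\<close> rows.\<close>

definition greedy_polynomial_time :: bool where
  "greedy_polynomial_time \<longleftrightarrow>
     (\<exists>c (q :: nat poly). \<forall>n M. matrix_instance n M \<longrightarrow>
        (\<exists>t R. computes_in c (enc_matrix M) t (enc_matrix R) \<and>
               t \<le> poly q (size (enc_matrix M)) \<and>
               greedy_output n M R))"

end

theory Submission
  imports Defs "HOL-Library.FuncSet"
begin

text \<open>
  Guarantee: consider a class \<open>P\<close> of an optimal cover, with \<open>k\<close> elements. As long as \<open>j\<close> of them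
  are uncovered, the next greedy set covers at least \<open>j\<close> elements, so \<open>P\<close> contributes at least
  \<open>1\<^sup>p + \<dots> + k\<^sup>p \<ge> k\<^sup>p\<^sup>+\<^sup>1 / (p + 1)\<close> to the greedy sum of \<open>p\<close>-th powers, compared to
  \<open>k\<^sup>p\<^sup>+\<^sup>1\<close> in the optimal one.
  Tightness: on a grid with \<open>k\<close> rows whose columns are optimal classes, the greedy algorithm can
  be forced to use only horizontal blocks, of sizes \<open>k + 1, k, \<dots>, 2\<close>.
  Running time: the polynomial-time functions on trees contain the basic operations and are closed
  under composition, case distinction, and iteration along a list with additive growth of the
  accumulator; the greedy algorithm is built from these.
\<close>

section \<open>Polynomial-time functions on trees\<close>

fun rename :: "(nat \<Rightarrow> nat) \<Rightarrow> wexp \<Rightarrow> wexp" where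
  "rename \<pi> (WVar x) = WVar (\<pi> x)"
| "rename \<pi> WLeaf = WLeaf"
| "rename \<pi> (WNode e f) = WNode (rename \<pi> e) (rename \<pi> f)"
| "rename \<pi> (WLeft e) = WLeft (rename \<pi> e)"
| "rename \<pi> (WRight e) = WRight (rename \<pi> e)"

fun rename_com :: "(nat \<Rightarrow> nat) \<Rightarrow> wcom \<Rightarrow> wcom" where
  "rename_com \<pi> (WAssign x e) = WAssign (\<pi> x) (rename \<pi> e)"
| "rename_com \<pi> (WSeq c d) = WSeq (rename_com \<pi> c) (rename_com \<pi> d)"
| "rename_com \<pi> (WIf e c d) = WIf (rename \<pi> e) (rename_com \<pi> c) (rename_com \<pi> d)"
| "rename_com \<pi> (WWhile e c) = WWhile (rename \<pi> e) (rename_com \<pi> c)"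

lemma wval_rename [simp]: "wval (rename \<pi> e) s = wval e (s \<circ> \<pi>)"
  by (induction e) auto

lemma wcost_rename [simp]: "wcost (rename \<pi> e) = wcost e"
  by (induction e) auto

text \<open>Injectivity keeps an assignment to \<open>\<pi> x\<close> from touching another renamed
  variable, so the run is copied step by step at the same cost. The last conjunct protects the
  variables of a caller.\<close>

lemma wexec_rename:
  assumes "wexec c s t s'" "inj \<pi>" "S \<circ> \<pi> = s"
  shows "\<exists>S'. wexec (rename_com \<pi> c) S t S' \<and> S' \<circ> \<pi> = s' \<and> (\<forall>x. x \<notin> range \<pi> \<longrightarrow> S' x = S x)"
  using assms
proof (induction arbitrary: S rule: wexec.induct)
  case (assign x e s)
  have "wexec (rename_com \<pi> (WAssign x e)) S (1 + wcost e) (S(\<pi> x := wval e s))"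
    using wexec.assign[of "\<pi> x" "rename \<pi> e" S] assign by simp
  moreover have "S(\<pi> x := wval e s) \<circ> \<pi> = s(x := wval e s)"
    using assign by (auto simp: fun_eq_iff inj_eq)
  ultimately show ?case by fastforce
next
  case (seq c s t s' d t' s'')
  obtain S' where S': "wexec (rename_com \<pi> c) S t S'" "S' \<circ> \<pi> = s'"
    "\<forall>x. x \<notin> range \<pi> \<longrightarrow> S' x = S x" using seq by blast
  obtain S'' where "wexec (rename_com \<pi> d) S' t' S''" "S'' \<circ> \<pi> = s''"
    "\<forall>x. x \<notin> range \<pi> \<longrightarrow> S'' x = S' x" using seq S' by blast
  then show ?case using S' by (auto intro!: exI[of _ S''] wexec.seq)
next
  case (if_true e s c t s' d)
  then obtain S' where S': "wexec (rename_com \<pi> c) S t S'" "S' \<circ> \<pi> = s'"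
    "\<forall>x. x \<notin> range \<pi> \<longrightarrow> S' x = S x" by blast
  then show ?case
    using wexec.if_true[of "rename \<pi> e" S "rename_com \<pi> c" t S' "rename_com \<pi> d"] if_true by auto
next
  case (if_false e s d t s' c)
  then obtain S' where S': "wexec (rename_com \<pi> d) S t S'" "S' \<circ> \<pi> = s'"
    "\<forall>x. x \<notin> range \<pi> \<longrightarrow> S' x = S x" by blast
  then show ?case
    using wexec.if_false[of "rename \<pi> e" S "rename_com \<pi> d" t S' "rename_com \<pi> c"] if_false by auto
next
  case (while_true e s c t s' t' s'')
  obtain S' where S': "wexec (rename_com \<pi> c) S t S'" "S' \<circ> \<pi> = s'"
    "\<forall>x. x \<notin> range \<pi> \<longrightarrow> S' x = S x" using while_true by blast
  obtain S'' where S'': "wexec (rename_com \<pi> (WWhile e c)) S' t' S''" "S'' \<circ> \<pi> = s''"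
    "\<forall>x. x \<notin> range \<pi> \<longrightarrow> S'' x = S' x" using while_true S' by blast
  moreover have "wval (rename \<pi> e) S \<noteq> Leaf"
    using while_true.hyps(1) while_true.prems(2) by (metis wval_rename)
  ultimately have "wexec (rename_com \<pi> (WWhile e c)) S (1 + wcost e + t + t') S''"
    using wexec.while_true[of "rename \<pi> e" S "rename_com \<pi> c" t S' t' S''] S' by simp
  then show ?case using S' S'' by (intro exI[of _ S'']) simp
next
  case (while_false e s c)
  then have "wval (rename \<pi> e) S = Leaf" by (metis wval_rename)
  from wexec.while_false[OF this, of "rename_com \<pi> c"] show ?case
    using while_false.prems(2) by (intro exI[of _ S]) simp
qed

text \<open>The base is at least \<open>2\<close>, so constants, sums and products are absorbed by a
  larger exponent, and a single power can serve as the bound.\<close>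

definition pbound :: "(dat \<Rightarrow> nat) \<Rightarrow> bool" where
  "pbound T \<longleftrightarrow> (\<exists>k. \<forall>d. T d \<le> (size d + 2) ^ k)"

lemma pbound_mono: "pbound T \<Longrightarrow> (\<And>d. T' d \<le> T d) \<Longrightarrow> pbound T'"
  unfolding pbound_def by (meson order_trans)

lemma pbound_const: "pbound (\<lambda>_. c)"
proof -
  have "c \<le> (n + 2) ^ c" for n :: nat
    using less_exp[of c] power_mono[of 2 "n + 2" c] by linarith
  then show ?thesis unfolding pbound_def by blast
qed

lemma pbound_size: "pbound size"
  unfolding pbound_def by (intro exI[of _ 1]) auto

lemma pbound_add:
  assumes "pbound T" "pbound U"
  shows "pbound (\<lambda>d. T d + U d)"
proof -
  obtain k l where kl: "\<And>d. T d \<le> (size d + 2) ^ k" "\<And>d. U d \<le> (size d + 2) ^ l"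
    using assms unfolding pbound_def by blast
  have "T d + U d \<le> (size d + 2) ^ (k + l + 1)" for d
  proof -
    have "T d \<le> (size d + 2) ^ (k + l)"
      by (rule order_trans[OF kl(1)]) (simp add: power_increasing)
    moreover have "U d \<le> (size d + 2) ^ (k + l)"
      by (rule order_trans[OF kl(2)]) (simp add: power_increasing)
    ultimately have "T d + U d \<le> 2 * (size d + 2) ^ (k + l)" by linarith
    also have "\<dots> \<le> (size d + 2) * (size d + 2) ^ (k + l)"
      by (rule mult_right_mono) auto
    finally show ?thesis by simp
  qed
  then show ?thesis unfolding pbound_def by blast
qed

lemma pbound_mult:
  assumes "pbound T" "pbound U"
  shows "pbound (\<lambda>d. T d * U d)"
proof -
  obtain k l where "\<And>d. T d \<le> (size d + 2) ^ k" "\<And>d. U d \<le> (size d + 2) ^ l"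
    using assms unfolding pbound_def by blast
  then have "T d * U d \<le> (size d + 2) ^ (k + l)" for d
    by (simp add: power_add mult_mono)
  then show ?thesis unfolding pbound_def by blast
qed

lemma pbound_power: "pbound T \<Longrightarrow> pbound (\<lambda>d. T d ^ k)"
  by (induction k) (auto intro: pbound_const pbound_mult)

lemmas pbound_intros = pbound_const pbound_size pbound_add pbound_mult pbound_power

text \<open>
  The program may start from arbitrary values of its scratch variables, so that it can be
  called repeatedly. The size bound is needed for composition and does not follow from the
  time bound: \<open>x := Node x x\<close> doubles a tree in constant time.
\<close>

definition ptime :: "(dat \<Rightarrow> dat) \<Rightarrow> bool" where
  "ptime f \<longleftrightarrow> pbound (\<lambda>d. size (f d)) \<and>
     (\<exists>c k. \<forall>s. \<exists>t s'. wexec c s t s' \<and> s' 0 = f (s 0) \<and> t \<le> (size (s 0) + 2) ^ k)"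

lemma ptime_size: "ptime f \<Longrightarrow> pbound (\<lambda>d. size (f d))"
  by (simp add: ptime_def)

lemma ptimeI:
  assumes "pbound (\<lambda>d. size (f d))" "pbound T"
    and "\<And>s. \<exists>t s'. wexec c s t s' \<and> s' 0 = f (s 0) \<and> t \<le> T (s 0)"
  shows "ptime f"
proof -
  obtain k where "\<And>d. T d \<le> (size d + 2) ^ k"
    using assms(2) unfolding pbound_def by blast
  then show ?thesis
    unfolding ptime_def using assms(1,3) by (meson order_trans)
qed

text \<open>Variables below \<open>5\<close> belong to the caller.\<close>

definition call :: "wcom \<Rightarrow> wexp \<Rightarrow> nat \<Rightarrow> wcom" where
  "call c e x = WSeq (WAssign 5 e) (WSeq (rename_com (\<lambda>n. n + 5) c) (WAssign x (WVar 5)))"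

text \<open>The calling interface: argument and target are chosen per call, and
  \<open>wcost e + 3\<close> pays for copying the argument in and the result out.\<close>

definition subroutine :: "(dat \<Rightarrow> dat) \<Rightarrow> (wexp \<Rightarrow> nat \<Rightarrow> wcom) \<Rightarrow> nat \<Rightarrow> bool" where
  "subroutine f C k \<longleftrightarrow> (\<forall>e x s. x < 5 \<longrightarrow>
     (\<exists>t s'. wexec (C e x) s t s' \<and> s' x = f (wval e s) \<and> (\<forall>y<5. y \<noteq> x \<longrightarrow> s' y = s y) \<and>
       t \<le> (size (wval e s) + 2) ^ k + wcost e + 3))"

lemma ptime_subroutine:
  assumes "ptime f"
  obtains C k where "subroutine f C k"
proof -
  obtain c k where c: "\<And>s. \<exists>t s'. wexec c s t s' \<and> s' 0 = f (s 0) \<and> t \<le> (size (s 0) + 2) ^ k"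
    using assms unfolding ptime_def by blast
  let ?\<pi> = "\<lambda>n :: nat. n + 5"
  have inj: "inj ?\<pi>" by (simp add: inj_def)
  have "subroutine f (call c) k"
    unfolding subroutine_def
  proof (intro allI impI)
    fix e x s assume x: "x < (5 :: nat)"
    let ?d = "wval e s" and ?S = "s(5 := wval e s)"
    obtain t s' where s': "wexec c (?S \<circ> ?\<pi>) t s'" "s' 0 = f ?d" "t \<le> (size ?d + 2) ^ k"
      using c[of "?S \<circ> ?\<pi>"] by auto
    obtain S' where S': "wexec (rename_com ?\<pi> c) ?S t S'" "S' \<circ> ?\<pi> = s'"
        "\<forall>x. x \<notin> range ?\<pi> \<longrightarrow> S' x = ?S x"
      using wexec_rename[OF s'(1) inj] by blast
    have S5: "S' 5 = f ?d" using fun_cong[OF S'(2), of 0] s'(2) by simp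
    have "wexec (call c e x) s ((1 + wcost e) + (t + (1 + wcost (WVar 5))))
        (S'(x := wval (WVar 5) S'))"
      unfolding call_def by (rule wexec.seq[OF wexec.assign wexec.seq[OF S'(1) wexec.assign]])
    moreover have "S' y = s y" if "y < 5" for y
    proof -
      have "y \<notin> range ?\<pi>" using that by auto
      then show ?thesis using S'(3) that by simp
    qed
    ultimately show "\<exists>t s'. wexec (call c e x) s t s' \<and> s' x = f ?d \<and>
        (\<forall>y<5. y \<noteq> x \<longrightarrow> s' y = s y) \<and> t \<le> (size ?d + 2) ^ k + wcost e + 3"
      using s'(3) S5 by (intro exI[of _ "(1 + wcost e) + (t + (1 + wcost (WVar 5)))"]
        exI[of _ "S'(x := wval (WVar 5) S')"]) auto
  qed
  then show thesis using that by blast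
qed

lemma subroutineD:
  assumes "subroutine f C k" "x < 5"
  obtains t s' where "wexec (C e x) s t s'" "s' x = f (wval e s)"
    "\<And>y. y < 5 \<Longrightarrow> y \<noteq> x \<Longrightarrow> s' y = s y" "t \<le> (size (wval e s) + 2) ^ k + wcost e + 3"
  using assms unfolding subroutine_def by blast

text \<open>One assignment has constant cost. The second assumption says that \<open>e\<close> reads
  variable \<open>0\<close> only.\<close>

lemma ptime_wval:
  assumes "pbound (\<lambda>d. size (wval e (\<lambda>_. d)))" "\<And>s. wval e s = wval e (\<lambda>_. s 0)"
  shows "ptime (\<lambda>d. wval e (\<lambda>_. d))"
proof (rule ptimeI)
  show "\<exists>t s'. wexec (WAssign 0 e) s t s' \<and> s' 0 = wval e (\<lambda>_. s 0) \<and> t \<le> 1 + wcost e" for s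
    using wexec.assign[of 0 e s] assms(2)[of s] by fastforce
qed (auto intro: pbound_const assms)

lemma size_left: "size (left d) \<le> size d" and size_right: "size (right d) \<le> size d"
  by (cases d; simp)+

lemma ptime_id: "ptime (\<lambda>d. d)"
  using ptime_wval[of "WVar 0"] by (simp add: pbound_size)

lemma ptime_Leaf: "ptime (\<lambda>_. Leaf)"
  using ptime_wval[of WLeaf] by (simp add: pbound_const)

text \<open>The time of \<open>f\<close> is a power of the size of \<open>g d\<close>; the size
  bound contained in \<open>ptime g\<close> makes it polynomial in the size of
  \<open>d\<close>.\<close>

lemma ptime_comp:
  assumes f: "ptime f" and g: "ptime g"
  shows "ptime (\<lambda>d. f (g d))"
proof -
  obtain C k where C: "subroutine f C k" using ptime_subroutine[OF f] .
  obtain D l where D: "subroutine g D l" using ptime_subroutine[OF g] .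
  obtain m where m: "\<And>d. size (f d) \<le> (size d + 2) ^ m"
    using ptime_size[OF f] unfolding pbound_def by blast
  note gs = ptime_size[OF g]
  show ?thesis
  proof (rule ptimeI)
    show "pbound (\<lambda>d. size (f (g d)))"
      by (rule pbound_mono[OF _ m]) (intro pbound_intros gs)
    show "pbound (\<lambda>d. (size d + 2) ^ l + (size (g d) + 2) ^ k + 8)"
      by (intro pbound_intros gs)
    fix s
    obtain t s' where 1: "wexec (D (WVar 0) 1) s t s'" "s' 1 = g (s 0)"
        "t \<le> (size (s 0) + 2) ^ l + 1 + 3"
      by (rule subroutineD[OF D, of 1 "WVar 0" s]) auto
    obtain t' s'' where 2: "wexec (C (WVar 1) 0) s' t' s''" "s'' 0 = f (s' 1)"
        "t' \<le> (size (s' 1) + 2) ^ k + 1 + 3"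
      by (rule subroutineD[OF C, of 0 "WVar 1" s']) auto
    show "\<exists>t s'. wexec (WSeq (D (WVar 0) 1) (C (WVar 1) 0)) s t s' \<and> s' 0 = f (g (s 0)) \<and>
        t \<le> (size (s 0) + 2) ^ l + (size (g (s 0)) + 2) ^ k + 8"
      using wexec.seq[OF 1(1) 2(1)] 1 2 by fastforce
  qed
qed

lemma ptime_left:
  assumes "ptime f"
  shows "ptime (\<lambda>d. left (f d))"
proof -
  have "ptime left"
    using ptime_wval[of "WLeft (WVar 0)"] pbound_mono[OF pbound_size size_left] by simp
  then show ?thesis using ptime_comp[of left f] assms by simp
qed

lemma ptime_right:
  assumes "ptime f"
  shows "ptime (\<lambda>d. right (f d))"
proof -
  have "ptime right"
    using ptime_wval[of "WRight (WVar 0)"] pbound_mono[OF pbound_size size_right] by simp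
  then show ?thesis using ptime_comp[of right f] assms by simp
qed

lemma ptime_Node:
  assumes f: "ptime f" and g: "ptime g"
  shows "ptime (\<lambda>d. Node (f d) (g d))"
proof -
  obtain C k where C: "subroutine f C k" using ptime_subroutine[OF f] .
  obtain D l where D: "subroutine g D l" using ptime_subroutine[OF g] .
  show ?thesis
  proof (rule ptimeI)
    have "pbound (\<lambda>d. size (f d) + size (g d) + 1)"
      by (intro pbound_intros ptime_size f g)
    then show "pbound (\<lambda>d. size (Node (f d) (g d)))" by simp
    show "pbound (\<lambda>d. (size d + 2) ^ k + (size d + 2) ^ l + 12)"
      by (intro pbound_intros)
    fix s
    obtain t s' where 1: "wexec (C (WVar 0) 1) s t s'" "s' 1 = f (s 0)" "s' 0 = s 0"
        "t \<le> (size (s 0) + 2) ^ k + 1 + 3"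
      by (rule subroutineD[OF C, of 1 "WVar 0" s]) auto
    obtain t' s'' where 2: "wexec (D (WVar 0) 2) s' t' s''" "s'' 2 = g (s' 0)" "s'' 1 = s' 1"
        "t' \<le> (size (s' 0) + 2) ^ l + 1 + 3"
      by (rule subroutineD[OF D, of 2 "WVar 0" s']) auto
    show "\<exists>t s'. wexec (WSeq (C (WVar 0) 1) (WSeq (D (WVar 0) 2)
          (WAssign 0 (WNode (WVar 1) (WVar 2))))) s t s' \<and> s' 0 = Node (f (s 0)) (g (s 0)) \<and>
        t \<le> (size (s 0) + 2) ^ k + (size (s 0) + 2) ^ l + 12"
      by (rule exI, rule exI, rule conjI, rule wexec.seq[OF 1(1) wexec.seq[OF 2(1) wexec.assign]])
        (use 1 2 in auto)
  qed
qed

lemma ptime_if: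
  assumes P: "ptime (\<lambda>d. enc_bool (P d))" and f: "ptime f" and g: "ptime g"
  shows "ptime (\<lambda>d. if P d then f d else g d)"
proof -
  obtain C k where C: "subroutine f C k" using ptime_subroutine[OF f] .
  obtain D l where D: "subroutine g D l" using ptime_subroutine[OF g] .
  obtain E m where E: "subroutine (\<lambda>d. enc_bool (P d)) E m" using ptime_subroutine[OF P] .
  show ?thesis
  proof (rule ptimeI)
    have "pbound (\<lambda>d. size (f d) + size (g d))"
      by (intro pbound_intros ptime_size f g)
    then show "pbound (\<lambda>d. size (if P d then f d else g d))" by (rule pbound_mono) auto
    show "pbound (\<lambda>d. (size d + 2) ^ m + (size d + 2) ^ k + (size d + 2) ^ l + 12)"
      by (intro pbound_intros)
    fix s
    obtain t s' where 1: "wexec (E (WVar 0) 1) s t s'" "s' 1 = enc_bool (P (s 0))" "s' 0 = s 0"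
        "t \<le> (size (s 0) + 2) ^ m + 1 + 3"
      by (rule subroutineD[OF E, of 1 "WVar 0" s]) auto
    obtain t' s'' where 2: "wexec (C (WVar 0) 0) s' t' s''" "s'' 0 = f (s' 0)"
        "t' \<le> (size (s' 0) + 2) ^ k + 1 + 3"
      by (rule subroutineD[OF C, of 0 "WVar 0" s']) auto
    obtain u r where 3: "wexec (D (WVar 0) 0) s' u r" "r 0 = g (s' 0)"
        "u \<le> (size (s' 0) + 2) ^ l + 1 + 3"
      by (rule subroutineD[OF D, of 0 "WVar 0" s']) auto
    show "\<exists>t s'. wexec (WSeq (E (WVar 0) 1) (WIf (WVar 1) (C (WVar 0) 0) (D (WVar 0) 0))) s t s' \<and>
        s' 0 = (if P (s 0) then f (s 0) else g (s 0)) \<and>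
        t \<le> (size (s 0) + 2) ^ m + (size (s 0) + 2) ^ k + (size (s 0) + 2) ^ l + 12"
    proof (cases "P (s 0)")
      case True
      then have nz: "wval (WVar 1) s' \<noteq> Leaf" using 1 by simp
      show ?thesis
        by (rule exI, rule exI, rule conjI, rule wexec.seq[OF 1(1) wexec.if_true[OF nz 2(1)]])
          (use 1 2 True in auto)
    next
      case False
      then have z: "wval (WVar 1) s' = Leaf" using 1 by simp
      show ?thesis
        by (rule exI, rule exI, rule conjI, rule wexec.seq[OF 1(1) wexec.if_false[OF z 3(1)]])
          (use 1 3 False in auto)
    qed
  qed
qed

section \<open>Iteration along a list\<close>

fun spine :: "dat \<Rightarrow> dat list" where
  "spine Leaf = []"
| "spine (Node x y) = x # spine y"

lemma length_spine_le: "length (spine d) \<le> size d"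
  by (induction d) auto

lemma size_spine_elem: "x \<in> set (spine d) \<Longrightarrow> size x \<le> size d"
  by (induction d) auto

text \<open>Variables \<open>0\<close>, \<open>1\<close>, \<open>2\<close> hold the context, the
  remaining list and the accumulator. The accumulator size plus \<open>G\<close> for every remaining
  element stays below \<open>B\<close>, which gives the same time bound for every iteration.\<close>

lemma fold_spine_while:
  assumes C: "subroutine (\<lambda>d. h (left d) (left (right d)) (right (right d))) C k"
    and G: "\<And>x y. x \<in> set (spine (s 1)) \<Longrightarrow> size (h (s 0) x y) \<le> size y + G"
    and "size (s 1) \<le> L" "size (s 2) + length (spine (s 1)) * G \<le> B"
  shows "\<exists>t s'. wexec (WWhile (WVar 1) (WSeq
        (C (WNode (WVar 0) (WNode (WLeft (WVar 1)) (WVar 2))) 2) (WAssign 1 (WRight (WVar 1))))) s t s' \<and>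
      s' 2 = fold (h (s 0)) (spine (s 1)) (s 2) \<and>
      t \<le> length (spine (s 1)) * ((size (s 0) + L + B + 4) ^ k + 14) + 2"
  using G assms(3-)
proof (induction "s 1" arbitrary: s)
  case Leaf
  then have "wval (WVar 1) s = Leaf" by simp
  then show ?case using wexec.while_false[of "WVar 1" s] Leaf by fastforce
next
  case (Node x y)
  note s1 = Node(3)[symmetric]
  let ?W = "WNode (WVar 0) (WNode (WLeft (WVar 1)) (WVar 2))"
  let ?T = "(size (s 0) + L + B + 4) ^ k + 14"
  obtain t r where r: "wexec (C ?W 2) s t r" "r 2 = h (s 0) x (s 2)" "r 0 = s 0" "r 1 = Node x y"
      "t \<le> (size (wval ?W s) + 2) ^ k + 9"
    by (rule subroutineD[OF C, of 2 ?W s]) (use s1 in auto)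
  let ?r = "r(1 := wval (WRight (WVar 1)) r)"
  \<comment> \<open>The two nodes of the argument and the \<open>2\<close> in the time bound of
    \<open>C\<close> make up the \<open>4\<close>.\<close>
  have "(size (wval ?W s) + 2) ^ k \<le> (size (s 0) + L + B + 4) ^ k"
    by (rule power_mono) (use Node.prems s1 in auto)
  then have t: "t \<le> (size (s 0) + L + B + 4) ^ k + 9" using r(5) by linarith
  have body: "wexec (WSeq (C ?W 2) (WAssign 1 (WRight (WVar 1)))) s (t + (1 + wcost (WRight (WVar 1)))) ?r"
    by (rule wexec.seq[OF r(1) wexec.assign])
  have "size (h (s 0) x (s 2)) \<le> size (s 2) + G"
    using Node.prems(1)[of x "s 2"] s1 by simp
  then have hx: "size (h (s 0) x (s 2)) + length (spine y) * G \<le> B"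
    using Node.prems(3) s1 by simp
  have "\<exists>t s'. wexec (WWhile (WVar 1) (WSeq (C ?W 2) (WAssign 1 (WRight (WVar 1))))) ?r t s' \<and>
      s' 2 = fold (h (?r 0)) (spine (?r 1)) (?r 2) \<and>
      t \<le> length (spine (?r 1)) * ((size (?r 0) + L + B + 4) ^ k + 14) + 2"
    by (intro Node.hyps(2)) (use Node.prems s1 r hx in auto)
  then obtain t' r' where r': "wexec (WWhile (WVar 1) (WSeq (C ?W 2) (WAssign 1 (WRight (WVar 1))))) ?r t' r'"
      "r' 2 = fold (h (s 0)) (spine y) (h (s 0) x (s 2))" "t' \<le> length (spine y) * ?T + 2"
    using r by auto
  have "wval (WVar 1) s \<noteq> Leaf" using s1 by simp
  from wexec.while_true[OF this body r'(1)] show ?case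
    by (rule_tac exI, rule_tac exI, rule_tac conjI, assumption) (use r' t s1 in auto)
qed

text \<open>The function \<open>h\<close> reads its context, the list element and the accumulator from a nested pair.\<close>

lemma ptime_fold:
  assumes l: "ptime l" and a: "ptime a"
    and h: "ptime (\<lambda>d. h (left d) (left (right d)) (right (right d)))"
    and G: "pbound G" "\<And>d x y. x \<in> set (spine (l d)) \<Longrightarrow> size (h d x y) \<le> size y + G d"
  shows "ptime (\<lambda>d. fold (h d) (spine (l d)) (a d))"
proof -
  obtain C k where C: "subroutine (\<lambda>d. h (left d) (left (right d)) (right (right d))) C k"
    using ptime_subroutine[OF h] .
  obtain D m where D: "subroutine l D m" using ptime_subroutine[OF l] .
  obtain E n where E: "subroutine a E n" using ptime_subroutine[OF a] .
  \<comment> \<open>Bounds every accumulator: the initial one, plus \<open>G d\<close> for each of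
    at most \<open>size (l d)\<close> elements.\<close>
  define B where "B d = size (a d) + size (l d) * G d" for d
  have B: "pbound B" unfolding B_def by (intro pbound_intros ptime_size l a G)
  define T where "T d = size (l d) * ((size d + size (l d) + B d + 4) ^ k + 14) + 2" for d
  have T: "pbound T" unfolding T_def by (intro pbound_intros ptime_size l a B)
  have fold_le: "size (fold (h d) xs y) \<le> size y + length xs * G d"
    if "set xs \<subseteq> set (spine (l d))" for d xs y
    using that
  proof (induction xs arbitrary: y)
    case (Cons x xs)
    then have "size (fold (h d) xs (h d x y)) \<le> size (h d x y) + length xs * G d" by simp
    also have "size (h d x y) \<le> size y + G d" using Cons.prems by (intro G) simp
    finally show ?case by simp
  qed simp
  show ?thesis
  proof (rule ptimeI)
    have "size (fold (h d) (spine (l d)) (a d)) \<le> B d" for d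
      using fold_le[OF subset_refl, of d "a d"]
        mult_right_mono[OF length_spine_le[of "l d"] le0, of "G d"]
      unfolding B_def by linarith
    then show "pbound (\<lambda>d. size (fold (h d) (spine (l d)) (a d)))"
      by (rule pbound_mono[OF B])
    show "pbound (\<lambda>d. (size d + 2) ^ m + (size d + 2) ^ n + T d + 12)"
      by (intro pbound_intros T)
    fix s
    obtain t s' where 1: "wexec (D (WVar 0) 1) s t s'" "s' 1 = l (s 0)" "s' 0 = s 0"
        "t \<le> (size (s 0) + 2) ^ m + 1 + 3"
      by (rule subroutineD[OF D, of 1 "WVar 0" s]) auto
    obtain t' s'' where 2: "wexec (E (WVar 0) 2) s' t' s''" "s'' 2 = a (s 0)" "s'' 1 = s' 1" "s'' 0 = s 0"
        "t' \<le> (size (s 0) + 2) ^ n + 1 + 3"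
      by (rule subroutineD[OF E, of 2 "WVar 0" s']) (use 1 in auto)
    have "size (s'' 2) + length (spine (s'' 1)) * G (s 0) \<le> B (s 0)"
      unfolding B_def using 1 2 mult_right_mono[OF length_spine_le[of "l (s 0)"] le0, of "G (s 0)"] by simp
    with fold_spine_while[OF C, of s'' "G (s 0)" "size (l (s 0))" "B (s 0)"]
    obtain u r where 3: "wexec (WWhile (WVar 1) (WSeq
        (C (WNode (WVar 0) (WNode (WLeft (WVar 1)) (WVar 2))) 2) (WAssign 1 (WRight (WVar 1))))) s'' u r"
      "r 2 = fold (h (s 0)) (spine (l (s 0))) (a (s 0))"
      "u \<le> length (spine (l (s 0))) * ((size (s 0) + size (l (s 0)) + B (s 0) + 4) ^ k + 14) + 2"
      using 1 2 G(2) by auto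
    have u: "u \<le> T (s 0)"
      using 3(3) mult_right_mono[OF length_spine_le[of "l (s 0)"] le0,
        of "(size (s 0) + size (l (s 0)) + B (s 0) + 4) ^ k + 14"]
      unfolding T_def by linarith
    show "\<exists>t s'. wexec (WSeq (D (WVar 0) 1) (WSeq (E (WVar 0) 2) (WSeq (WWhile (WVar 1) (WSeq
        (C (WNode (WVar 0) (WNode (WLeft (WVar 1)) (WVar 2))) 2) (WAssign 1 (WRight (WVar 1)))))
        (WAssign 0 (WVar 2))))) s t s' \<and>
        s' 0 = fold (h (s 0)) (spine (l (s 0))) (a (s 0)) \<and>
        t \<le> (size (s 0) + 2) ^ m + (size (s 0) + 2) ^ n + T (s 0) + 12"
      by (rule exI, rule exI, rule conjI,
          rule wexec.seq[OF 1(1) wexec.seq[OF 2(1) wexec.seq[OF 3(1) wexec.assign]]])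
        (use 1(4) 2(5) 3(2) u in auto)
  qed
qed

lemma ptime_False: "ptime (\<lambda>_. enc_bool False)"
  by (simp add: ptime_Leaf)

lemma ptime_True: "ptime (\<lambda>_. enc_bool True)"
  by (simp add: ptime_Leaf ptime_Node)

text \<open>Folding with a constant false function lets the initial true survive only if the spine
  is empty, that is, for a leaf.\<close>

lemma ptime_eq_Leaf:
  assumes f: "ptime f"
  shows "ptime (\<lambda>d. enc_bool (f d = Leaf))"
proof -
  have "ptime (\<lambda>d. fold (\<lambda>_ _. enc_bool False) (spine (f d)) (enc_bool True))"
    by (rule ptime_fold[where G = "\<lambda>_. 0"]) (simp_all add: f ptime_True ptime_Leaf pbound_const del: enc_bool.simps(2))
  moreover have "fold (\<lambda>_ _. Leaf) (spine d) Leaf = Leaf" for d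
    by (induction d) auto
  then have "fold (\<lambda>_ _. enc_bool False) (spine d) (enc_bool True) = enc_bool (d = Leaf)" for d
    by (cases d) auto
  ultimately show ?thesis by simp
qed

lemma ptime_not:
  assumes "ptime (\<lambda>d. enc_bool (P d))"
  shows "ptime (\<lambda>d. enc_bool (\<not> P d))"
proof -
  have "enc_bool (\<not> P d) = (if P d then enc_bool False else enc_bool True)" for d by simp
  then show ?thesis using ptime_if[OF assms ptime_False ptime_True] by presburger
qed

lemma ptime_conj:
  assumes "ptime (\<lambda>d. enc_bool (P d))" "ptime (\<lambda>d. enc_bool (Q d))"
  shows "ptime (\<lambda>d. enc_bool (P d \<and> Q d))"
proof -
  have "enc_bool (P d \<and> Q d) = (if P d then enc_bool (Q d) else enc_bool False)" for d by simp
  then show ?thesis using ptime_if[OF assms ptime_False] by presburger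
qed

lemmas ptime_intros = ptime_id ptime_Leaf ptime_left ptime_right ptime_Node ptime_if
  ptime_eq_Leaf ptime_not ptime_conj


section \<open>The greedy algorithm on trees\<close>

text \<open>
  The state is a list \<open>R\<close> with the entry \<open>Leaf\<close> at the uncovered elements; since the rows are
  nonempty if there are elements at all, no row is encoded by a leaf. Numbers are represented
  in unary by the lengths of spines.
\<close>

text \<open>The accumulator holds the remaining entries of \<open>R\<close> and the reversed result.\<close>

definition rev_zip :: "dat \<Rightarrow> dat \<Rightarrow> dat" where
  "rev_zip A R = right (fold (\<lambda>x a. Node (right (left a)) (Node (Node x (left (left a))) (right a)))
     (spine A) (Node R Leaf))"

text \<open>An entry of a zipped list has the incidence bit on the left and the state entry on the
  right: the element is in the row and still uncovered.\<close>

definition fresh :: "dat \<Rightarrow> bool" where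
  "fresh x \<longleftrightarrow> left x \<noteq> Leaf \<and> right x = Leaf"

definition gain :: "dat \<Rightarrow> dat \<Rightarrow> dat" where
  "gain A R = fold (\<lambda>x a. if fresh x then Node Leaf a else a) (spine (rev_zip A R)) Leaf"

text \<open>The fold reverses the list a second time and so restores the order that
  \<open>rev_zip\<close> reversed.\<close>

definition update :: "dat \<Rightarrow> dat \<Rightarrow> dat" where
  "update A R = fold (\<lambda>x a. Node (if fresh x then A else right x) a) (spine (rev_zip A R)) Leaf"

text \<open>Truncated subtraction of unary numbers, used to compare them.\<close>

definition tdrop :: "dat \<Rightarrow> dat \<Rightarrow> dat" where
  "tdrop c d = fold (\<lambda>_ a. right a) (spine c) d"

definition best_row :: "dat \<Rightarrow> dat \<Rightarrow> dat" where
  "best_row M R = fold (\<lambda>A B. if tdrop (gain A R) (gain B R) = Leaf then A else B) (spine M) (left M)"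

text \<open>On an encoded instance the spine of \<open>left M\<close> has one entry per element.
  Every round covers a further element while any is left, so that many rounds suffice.\<close>

definition tgreedy :: "dat \<Rightarrow> dat" where
  "tgreedy M = fold (\<lambda>_ R. update (best_row M R) R) (spine (left M))
     (fold (\<lambda>_ a. Node Leaf a) (spine (left M)) Leaf)"

section \<open>Running time of the greedy operations\<close>

lemma ptime_rev_zip:
  assumes f: "ptime f" and g: "ptime g"
  shows "ptime (\<lambda>d. rev_zip (f d) (g d))"
  unfolding rev_zip_def
proof (intro ptime_right ptime_fold f ptime_Node g ptime_Leaf)
  show "pbound (\<lambda>d. size (f d) + 3)" by (intro pbound_intros ptime_size f)
  fix d x y assume "x \<in> set (spine (f d))"
  then have "size x \<le> size (f d)" by (rule size_spine_elem)
  \<comment> \<open>The head of the remaining list only changes its place, so it is already paid for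
    by \<open>size y\<close>.\<close>
  moreover have "size (right (left y)) + size (left (left y)) + size (right y) \<le> size y"
    by (cases y; cases "left y") auto
  ultimately show "size (Node (right (left y)) (Node (Node x (left (left y))) (right y)))
      \<le> size y + (size (f d) + 3)" by simp
qed (intro ptime_intros)+

lemma ptime_fresh: "ptime f \<Longrightarrow> ptime (\<lambda>d. enc_bool (fresh (f d)))"
  unfolding fresh_def by (intro ptime_intros)

lemma ptime_gain:
  assumes f: "ptime f" and g: "ptime g"
  shows "ptime (\<lambda>d. gain (f d) (g d))"
  unfolding gain_def
  by (rule ptime_fold[where G = "\<lambda>_. 1"])
    ((intro ptime_intros ptime_fresh ptime_rev_zip f g pbound_const)+, simp)

lemma ptime_update:
  assumes f: "ptime f" and g: "ptime g"
  shows "ptime (\<lambda>d. update (f d) (g d))"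
  unfolding update_def
proof (rule ptime_fold)
  let ?z = "\<lambda>d. rev_zip (f d) (g d)"
  show "ptime ?z" by (intro ptime_rev_zip f g)
  show "pbound (\<lambda>d. size (f d) + size (?z d) + 1)"
    by (intro pbound_intros ptime_size ptime_rev_zip f g)
  fix d x y assume "x \<in> set (spine (?z d))"
  then have "size x \<le> size (?z d)" by (rule size_spine_elem)
  then show "size (Node (if fresh x then f d else right x) y) \<le> size y + (size (f d) + size (?z d) + 1)"
    using size_right[of x] by simp
qed (intro ptime_intros ptime_fresh ptime_comp[OF f])+

lemma ptime_tdrop:
  assumes f: "ptime f" and g: "ptime g"
  shows "ptime (\<lambda>d. tdrop (f d) (g d))"
  unfolding tdrop_def
  by (rule ptime_fold[where G = "\<lambda>_. 0"])
    ((intro ptime_intros f g pbound_const)+, simp add: size_right)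

text \<open>The fold only selects and never builds a tree; this bounds the size of the chosen row by
  that of \<open>M\<close>, whatever the state.\<close>

lemma best_row_cases: "best_row M R \<in> insert (left M) (set (spine M))"
proof -
  have "fold (\<lambda>A B. if P A B then A else B) xs b \<in> insert b (set xs)" for P xs and b :: dat
    by (induction xs arbitrary: b) fastforce+
  then show ?thesis unfolding best_row_def .
qed

lemma size_best_row: "size (best_row M R) \<le> size M"
  using best_row_cases[of M R] size_left size_spine_elem by auto

lemma ptime_best_row:
  assumes f: "ptime f" and g: "ptime g"
  shows "ptime (\<lambda>d. best_row (f d) (g d))"
  unfolding best_row_def
proof (rule ptime_fold)
  show "pbound (\<lambda>d. size (f d))" by (intro ptime_size f)
  fix d x y assume "x \<in> set (spine (f d))"
  then have "size x \<le> size (f d)" by (rule size_spine_elem)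
  then show "size (if tdrop (gain x (g d)) (gain y (g d)) = Leaf then x else y) \<le> size y + size (f d)"
    by simp
qed (intro ptime_intros f ptime_tdrop ptime_gain ptime_comp[OF g])+

text \<open>In \<open>tgreedy\<close> the state \<open>R\<close> is the accumulator, so its growth
  must be bounded independently of \<open>R\<close>. The old entries together have at most the size
  of \<open>R\<close>, and every element of the spine of \<open>A\<close> adds at most a copy of
  \<open>A\<close> and a list node.\<close>

lemma size_update: "size (update A R) \<le> size R + size A * (size A + 1)"
proof -
  define h where "h = (\<lambda>x a. Node (right (left a)) (Node (Node x (left (left a))) (right a)))"
  define w where "w d = (\<Sum>x\<leftarrow>spine d. size (right x))" for d
  \<comment> \<open>Each round moves a state entry from the remaining list to the zipped one, so the
    sum of \<open>w\<close> and the remaining size does not grow.\<close>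
  have zip: "w (right (fold h xs a)) \<le> w (right a) + size (left a) \<and>
      length (spine (right (fold h xs a))) = length xs + length (spine (right a))" for xs a
  proof (induction xs arbitrary: a)
    case (Cons x xs)
    have "w (right (h x a)) + size (left (h x a)) \<le> w (right a) + size (left a)"
      by (cases "left a") (auto simp: h_def w_def)
    then show ?case using Cons[of "h x a"] by (simp add: h_def)
  qed simp
  have upd: "size (fold (\<lambda>x a. Node (if fresh x then A else right x) a) xs b)
      \<le> size b + (\<Sum>x\<leftarrow>xs. size (right x)) + length xs * (size A + 1)" for xs b
  proof (induction xs arbitrary: b)
    case (Cons x xs)
    show ?case
      using Cons[of "Node (if fresh x then A else right x) b"] by (simp split: if_splits)
  qed simp
  have "w (rev_zip A R) \<le> size R" "length (spine (rev_zip A R)) = length (spine A)"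
    using zip[of "spine A" "Node R Leaf"] by (simp_all add: rev_zip_def h_def w_def)
  then have "size (update A R) \<le> size R + length (spine A) * (size A + 1)"
    using upd[of "spine (rev_zip A R)" Leaf] unfolding update_def w_def by simp
  also have "\<dots> \<le> size R + size A * (size A + 1)"
    by (intro add_left_mono mult_right_mono length_spine_le) simp
  finally show ?thesis .
qed

lemma ptime_tgreedy: "ptime tgreedy"
  unfolding tgreedy_def
proof (rule ptime_fold)
  show "ptime (\<lambda>M. fold (\<lambda>_ a. Node Leaf a) (spine (left M)) Leaf)"
    by (rule ptime_fold[where G = "\<lambda>_. 1"]) ((intro ptime_intros pbound_const)+, simp)
  show "pbound (\<lambda>M. size M * (size M + 1))" by (intro pbound_intros)
  fix M x R assume "x \<in> set (spine (left M))"
  show "size (update (best_row M R) R) \<le> size R + size M * (size M + 1)"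
    by (rule order_trans[OF size_update])
      (intro add_left_mono mult_mono add_right_mono size_best_row; simp)
qed (intro ptime_intros ptime_update ptime_best_row)+


section \<open>Correctness on encoded instances\<close>

lemma spine_enc_list [simp]: "spine (enc_list f xs) = map f xs"
  by (induction xs) auto

lemma enc_list_eq_Leaf [simp]: "enc_list f xs = Leaf \<longleftrightarrow> xs = []"
  by (cases xs) auto

lemma enc_list_cong: "(\<And>x. x \<in> set xs \<Longrightarrow> f x = g x) \<Longrightarrow> enc_list f xs = enc_list g xs"
  by (induction xs) auto

text \<open>Brings rows and states to the form of two functions on one common index list, as
  \<open>rev_zip_enc_list\<close> expects.\<close>

lemma enc_list_conv_nth: "enc_list f xs = enc_list (\<lambda>i. f (xs ! i)) [0..<length xs]"
proof -
  have "enc_list f (map g ys) = enc_list (\<lambda>y. f (g y)) ys" for g and ys :: "nat list"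
    by (induction ys) auto
  from this[of "(!) xs" "[0..<length xs]"] show ?thesis by (simp add: map_nth)
qed

lemma rev_zip_enc_list:
  "rev_zip (enc_list f xs) (enc_list g xs) = enc_list (\<lambda>i. Node (f i) (g i)) (rev xs)"
proof -
  \<comment> \<open>Generalized over the entries \<open>ys\<close> that are already zipped.\<close>
  have "fold (\<lambda>x a. Node (right (left a)) (Node (Node x (left (left a))) (right a))) (map f xs)
      (Node (enc_list g xs) (enc_list h ys)) = Node Leaf (enc_list h (rev xs @ ys))"
    if "h = (\<lambda>i. Node (f i) (g i))" for ys h
    using that
  proof (induction xs arbitrary: ys)
    case (Cons x xs)
    then show ?case using Cons.IH[of "x # ys"] by simp
  qed simp
  from this[OF refl, of "[]"] show ?thesis by (simp add: rev_zip_def)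
qed

lemma length_spine_gain:
  "length (spine (gain (enc_list f xs) (enc_list g xs))) =
    length (filter (\<lambda>i. f i \<noteq> Leaf \<and> g i = Leaf) xs)"
proof -
  have "length (spine (fold (\<lambda>x a. if fresh x then Node Leaf a else a)
      (map (\<lambda>i. Node (f i) (g i)) ys) a)) =
      length (filter (\<lambda>i. f i \<noteq> Leaf \<and> g i = Leaf) ys) + length (spine a)" for ys a
    by (induction ys arbitrary: a) (auto simp: fresh_def)
  then show ?thesis by (simp add: gain_def rev_zip_enc_list flip: rev_filter)
qed

lemma update_enc_list:
  "update (enc_list f xs) (enc_list g xs) =
    enc_list (\<lambda>i. if f i \<noteq> Leaf \<and> g i = Leaf then enc_list f xs else g i) xs"
proof -
  have "fold (\<lambda>x a. Node (if fresh x then A else right x) a)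
      (map (\<lambda>i. Node (f i) (g i)) (rev ys)) (enc_list h zs) = enc_list h (ys @ zs)"
    if "h = (\<lambda>i. if f i \<noteq> Leaf \<and> g i = Leaf then A else g i)" for ys zs A h
    using that
  proof (induction ys arbitrary: zs rule: rev_induct)
    case (snoc y ys)
    then show ?case using snoc.IH[of "y # zs"]
      by (cases "f y \<noteq> Leaf \<and> g y = Leaf") (auto simp: fresh_def)
  qed simp
  from this[OF refl, of _ xs "[]"] show ?thesis by (simp add: update_def rev_zip_enc_list)
qed

text \<open>Since \<open>right Leaf = Leaf\<close>, dropping beyond the end stays at a leaf, as in
  subtraction truncated at zero.\<close>

lemma tdrop_eq_Leaf: "tdrop c d = Leaf \<longleftrightarrow> length (spine d) \<le> length (spine c)"
proof -
  have "fold (\<lambda>_ a. right a) xs d = Leaf \<longleftrightarrow> length (spine d) \<le> length xs" for xs :: "dat list"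
  proof (induction xs arbitrary: d)
    case Nil
    show ?case by (cases d) auto
  next
    case (Cons x xs)
    then show ?case by (cases d) auto
  qed
  then show ?thesis by (simp add: tdrop_def)
qed

lemma fold_max:
  fixes m :: "'b \<Rightarrow> nat"
  shows "fold (\<lambda>x y. if m y \<le> m x then x else y) xs b \<in> insert b (set xs) \<and>
    (\<forall>x\<in>insert b (set xs). m x \<le> m (fold (\<lambda>x y. if m y \<le> m x then x else y) xs b))"
proof (induction xs arbitrary: b)
  case (Cons x xs)
  then show ?case using Cons[of "if m b \<le> m x then x else b"] by (fastforce split: if_splits)
qed simp

section \<open>Greedy steps on encoded states\<close>

definition enc_row :: "bool list \<Rightarrow> dat" where
  "enc_row r = enc_list enc_bool r"

definition enc_state :: "nat \<Rightarrow> nat set \<Rightarrow> (nat \<Rightarrow> bool list) \<Rightarrow> dat" where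
  "enc_state n U \<rho> = enc_list (\<lambda>i. if i \<in> U then Leaf else enc_row (\<rho> i)) [0..<n]"

lemma enc_row_conv_nth: "length r = n \<Longrightarrow> enc_row r = enc_list (\<lambda>i. enc_bool (r ! i)) [0..<n]"
  unfolding enc_row_def by (subst enc_list_conv_nth) simp

lemma enc_bool_eq_Leaf [simp]: "enc_bool b = Leaf \<longleftrightarrow> \<not> b"
  by (cases b) auto

context
  fixes n :: nat and M :: "bool list list" and U :: "nat set" and \<rho> :: "nat \<Rightarrow> bool list"
  assumes rows: "\<forall>r\<in>set M. length r = n" and U: "U \<subseteq> {..<n}"
    and \<rho>: "\<And>i. i < n \<Longrightarrow> i \<notin> U \<Longrightarrow> \<rho> i \<in> set M"
begin

text \<open>An assigned row has length \<open>n > i\<close>, so it is nonempty and its code cannot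
  be confused with the leaf that marks uncovered elements.\<close>

lemma uncovered_iff: "i < n \<Longrightarrow> (if i \<in> U then Leaf else enc_row (\<rho> i)) = Leaf \<longleftrightarrow> i \<in> U"
  using bspec[OF rows \<rho>[of i]] by (auto simp: enc_row_def)

lemma length_gain_state:
  assumes "r \<in> set M"
  shows "length (spine (gain (enc_row r) (enc_state n U \<rho>))) = card (row_set r \<inter> U)"
proof -
  have len: "length r = n" using rows assms by blast
  have "length (spine (gain (enc_row r) (enc_state n U \<rho>))) =
      length (filter (\<lambda>i. r ! i \<and> i \<in> U) [0..<n])"
    unfolding enc_row_conv_nth[OF len] enc_state_def length_spine_gain
    by (intro arg_cong[where f = length] filter_cong) (auto simp: uncovered_iff)
  also have "\<dots> = card (set (filter (\<lambda>i. r ! i \<and> i \<in> U) [0..<n]))"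
    by (simp add: distinct_card[symmetric])
  also have "set (filter (\<lambda>i. r ! i \<and> i \<in> U) [0..<n]) = row_set r \<inter> U"
    using U len by (auto simp: row_set_def)
  finally show ?thesis .
qed

lemma update_state:
  assumes "r \<in> set M"
  shows "update (enc_row r) (enc_state n U \<rho>) =
    enc_state n (U - row_set r) (\<lambda>i. if i \<in> row_set r \<inter> U then r else \<rho> i)"
proof -
  have len: "length r = n" using rows assms by blast
  show ?thesis
    unfolding enc_row_conv_nth[OF len] enc_state_def update_enc_list
    by (rule enc_list_cong) (auto simp: uncovered_iff row_set_def len enc_row_conv_nth[OF len, symmetric])
qed

lemma best_row_state:
  assumes "M \<noteq> []"
  obtains r where "r \<in> set M" "best_row (enc_matrix M) (enc_state n U \<rho>) = enc_row r"
    "\<And>r'. r' \<in> set M \<Longrightarrow> card (row_set r' \<inter> U) \<le> card (row_set r \<inter> U)"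
proof -
  let ?m = "\<lambda>A. length (spine (gain A (enc_state n U \<rho>)))"
  have hd: "left (enc_matrix M) = enc_row (hd M)"
    using assms by (cases M) (auto simp: enc_matrix_def enc_row_def)
  have sp: "spine (enc_matrix M) = map enc_row M"
    by (simp add: enc_matrix_def enc_row_def fun_eq_iff)
  have best: "best_row (enc_matrix M) (enc_state n U \<rho>) \<in> insert (enc_row (hd M)) (enc_row ` set M)"
    "\<And>A. A \<in> enc_row ` set M \<Longrightarrow> ?m A \<le> ?m (best_row (enc_matrix M) (enc_state n U \<rho>))"
    using fold_max[of ?m "map enc_row M" "enc_row (hd M)"]
    unfolding best_row_def hd sp tdrop_eq_Leaf by auto
  then obtain r where "r \<in> set M" "best_row (enc_matrix M) (enc_state n U \<rho>) = enc_row r"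
    using assms by auto
  then show thesis using best(2) that by (metis image_eqI length_gain_state)
qed

end

text \<open>Some set meets \<open>U\<close>, hence so does a set that covers the maximum number of
  elements of \<open>U\<close>.\<close>

lemma greedy_step_card_less:
  assumes "finite U" "U \<subseteq> \<Union>S" "greedy_step S (U, \<phi>) (U', \<phi>')"
  shows "card U' < card U"
  using assms(3)
proof cases
  case (1 A)
  obtain v B where "v \<in> U" "v \<in> B" "B \<in> S" using 1 assms(2) by blast
  then have "card (B \<inter> U) \<noteq> 0" using assms(1) by auto
  then have "card (A \<inter> U) \<noteq> 0" using 1 \<open>B \<in> S\<close> by (metis le_zero_eq)
  then have "U - A \<subset> U" by (metis Diff_Diff_Int Diff_cancel Diff_subset Int_commute card.empty psubsetI)
  then show ?thesis using 1 assms(1) by (simp add: psubset_card_mono)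
qed

text \<open>The choices depend on the uncovered set only, so the same run is possible from any other
  assignment \<open>\<psi>\<close>, which survives exactly outside \<open>U - U'\<close>.\<close>

lemma greedy_run_replay:
  assumes "(greedy_step S)\<^sup>*\<^sup>* (U, \<phi>) (U', \<phi>')"
  shows "U' \<subseteq> U \<and> (greedy_step S)\<^sup>*\<^sup>* (U, \<psi>) (U', \<lambda>v. if v \<in> U - U' then \<phi>' v else \<psi> v)"
  using assms
proof (induction rule: rtranclp_induct2)
  case refl
  then show ?case by simp
next
  case (step W \<chi> W' \<chi>')
  from step.hyps(2) show ?case
  proof cases
    case (1 A)
    let ?f = "\<lambda>v. if v \<in> U - W then \<chi> v else \<psi> v"
    have "greedy_step S (W, ?f) (W', \<lambda>v. if v \<in> A \<inter> W then A else ?f v)"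
      using 1 greedy_step.intros[of W A S ?f] by simp
    moreover have "(\<lambda>v. if v \<in> A \<inter> W then A else ?f v) = (\<lambda>v. if v \<in> U - W' then \<chi>' v else \<psi> v)"
      using 1 step.IH by (auto simp: fun_eq_iff)
    ultimately show ?thesis using 1 step.IH by (auto intro: rtranclp.rtrancl_into_rtrancl)
  qed
qed

text \<open>
  The output condition also constrains the assignment at indices beyond the list of rows; the
  freedom in the initial assignment absorbs this.
\<close>

lemma greedy_cover_cong:
  assumes "greedy_cover V S \<phi>" "\<And>v. v \<in> V \<Longrightarrow> \<phi> v = \<psi> v"
  shows "greedy_cover V S \<psi>"
proof -
  obtain \<phi>\<^sub>0 where "(greedy_step S)\<^sup>*\<^sup>* (V, \<phi>\<^sub>0) ({}, \<phi>)"
    using assms(1) unfolding greedy_cover_def by blast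
  then have "(greedy_step S)\<^sup>*\<^sup>* (V, \<psi>) ({}, \<lambda>v. if v \<in> V - {} then \<phi> v else \<psi> v)"
    using greedy_run_replay by blast
  moreover have "(\<lambda>v. if v \<in> V - {} then \<phi> v else \<psi> v) = \<psi>"
    using assms(2) by (auto simp: fun_eq_iff)
  ultimately show ?thesis unfolding greedy_cover_def by auto
qed

text \<open>\<open>S\<close> is finite because its union is, so a maximizing set exists in every
  state, and the number of uncovered elements decreases.\<close>

lemma greedy_cover_exists:
  assumes "set_cover_instance V S"
  shows "\<exists>\<phi>. greedy_cover V S \<phi>"
proof -
  have fin: "finite V" and V: "\<Union>S = V" using assms by (auto simp: set_cover_instance_def)
  then have "finite S" by (simp add: finite_UnionD)
  have "\<exists>\<phi>'. (greedy_step S)\<^sup>*\<^sup>* (U, \<phi>) ({}, \<phi>')" if "U \<subseteq> V" for U \<phi>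
    using that
  proof (induction "card U" arbitrary: U \<phi> rule: less_induct)
    case less
    show ?case
    proof (cases "U = {}")
      case False
      then have "S \<noteq> {}" using less.prems V by blast
      then obtain A where A: "A \<in> S" "\<forall>B\<in>S. card (B \<inter> U) \<le> card (A \<inter> U)"
        using \<open>finite S\<close> obtains_MAX[of S "\<lambda>B. card (B \<inter> U)"] by (metis Max_ge finite_imageI imageI)
      then have step: "greedy_step S (U, \<phi>) (U - A, \<lambda>v. if v \<in> A \<inter> U then A else \<phi> v)"
        using False by (intro greedy_step.intros)
      then have "card (U - A) < card U"
        using greedy_step_card_less less.prems fin V finite_subset by metis
      then show ?thesis using less(1)[of "U - A"] less.prems step
        by (meson Diff_subset converse_rtranclp_into_rtranclp order_trans)
    qed auto
  qed
  then show ?thesis unfolding greedy_cover_def by blast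
qed

lemma tgreedy_correct:
  assumes "matrix_instance n M"
  obtains R where "tgreedy (enc_matrix M) = enc_matrix R" "greedy_output n M R"
proof -
  let ?V = "{..<n}" and ?S = "row_set ` set M"
  have rows: "\<forall>r\<in>set M. length r = n" and cov: "\<Union>?S = ?V"
    using assms by (auto simp: matrix_instance_def set_cover_instance_def)
  have len: "length (spine (left (enc_matrix M))) = n"
    using rows cov by (cases M) (auto simp: enc_matrix_def lessThan_empty_iff)
  let ?step = "\<lambda>_. \<lambda>R. update (best_row (enc_matrix M) R) R"
  define \<rho>\<^sub>0 :: "nat \<Rightarrow> bool list" where "\<rho>\<^sub>0 = (\<lambda>_. [])"
  have init: "fold (\<lambda>_ a. Node Leaf a) (spine (left (enc_matrix M))) Leaf = enc_state n ?V \<rho>\<^sub>0"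
  proof -
    have "fold (\<lambda>_ a. Node Leaf a) (xs :: dat list) (enc_list (\<lambda>_. Leaf) (ys :: nat list)) =
        enc_list (\<lambda>_. Leaf) [0..<length xs + length ys]" for xs ys
    proof (induction xs arbitrary: ys)
      case Nil
      show ?case by (simp add: enc_list_conv_nth[of _ ys])
    next
      case (Cons x xs)
      then show ?case using Cons[of "0 # ys"] by simp
    qed
    from this[of "spine (left (enc_matrix M))" "[]"]
    have "fold (\<lambda>_ a. Node Leaf a) (spine (left (enc_matrix M))) Leaf = enc_list (\<lambda>_. Leaf) [0..<n]"
      by (simp add: len)
    also have "\<dots> = enc_state n ?V \<rho>\<^sub>0"
      unfolding enc_state_def by (rule enc_list_cong) auto
    finally show ?thesis .
  qed
  \<comment> \<open>Simulation invariant: the tree encodes a state reachable by greedy steps, and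
    each round lowers the bound on the uncovered elements by one.\<close>
  have "\<exists>U \<rho>. fold ?step xs (enc_state n ?V \<rho>\<^sub>0) = enc_state n U \<rho> \<and> U \<subseteq> ?V \<and>
      (\<forall>i<n. i \<notin> U \<longrightarrow> \<rho> i \<in> set M) \<and> card U \<le> n - length xs \<and>
      (greedy_step ?S)\<^sup>*\<^sup>* (?V, \<lambda>v. row_set (\<rho>\<^sub>0 v)) (U, \<lambda>v. row_set (\<rho> v))" for xs :: "dat list"
  proof (induction xs rule: rev_induct)
    case Nil
    show ?case by (intro exI[of _ ?V] exI[of _ \<rho>\<^sub>0]) auto
  next
    case (snoc x xs)
    then obtain U \<rho> where U: "fold ?step xs (enc_state n ?V \<rho>\<^sub>0) = enc_state n U \<rho>" "U \<subseteq> ?V"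
      "\<And>i. i < n \<Longrightarrow> i \<notin> U \<Longrightarrow> \<rho> i \<in> set M" "card U \<le> n - length xs"
      "(greedy_step ?S)\<^sup>*\<^sup>* (?V, \<lambda>v. row_set (\<rho>\<^sub>0 v)) (U, \<lambda>v. row_set (\<rho> v))" by blast
    show ?case
    proof (cases "M = []")
      case True
      then have "n = 0" using cov by (cases n) auto
      then show ?thesis using True by (intro exI[of _ ?V] exI[of _ \<rho>\<^sub>0])
        (auto simp: enc_state_def enc_matrix_def U(1) best_row_def update_def rev_zip_def)
    next
      case False
      obtain r where r: "r \<in> set M" "best_row (enc_matrix M) (enc_state n U \<rho>) = enc_row r"
        "\<And>r'. r' \<in> set M \<Longrightarrow> card (row_set r' \<inter> U) \<le> card (row_set r \<inter> U)"
        using best_row_state[of M n U \<rho>, OF rows U(2,3) False] by blast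
      let ?\<rho> = "\<lambda>i. if i \<in> row_set r \<inter> U then r else \<rho> i"
      have 1: "fold ?step (xs @ [x]) (enc_state n ?V \<rho>\<^sub>0) = enc_state n (U - row_set r) ?\<rho>"
        using U(1) r(2) update_state[of M n U \<rho>, OF rows U(2,3) r(1)] by simp
      have eq: "(\<lambda>v. row_set (?\<rho> v)) =
          (\<lambda>v. if v \<in> row_set r \<inter> U then row_set r else row_set (\<rho> v))" by (simp add: fun_eq_iff)
      have 2: "card (U - row_set r) \<le> n - length (xs @ [x]) \<and>
        (greedy_step ?S)\<^sup>*\<^sup>* (?V, \<lambda>v. row_set (\<rho>\<^sub>0 v)) (U - row_set r, \<lambda>v. row_set (?\<rho> v))"
      \<comment> \<open>Once everything is covered, a surplus round leaves the state as it is and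
        corresponds to no greedy step.\<close>
      proof (cases "U = {}")
        case True
        then show ?thesis using U(5) by simp
      next
        case False
        then have step: "greedy_step ?S (U, \<lambda>v. row_set (\<rho> v)) (U - row_set r, \<lambda>v. row_set (?\<rho> v))"
          unfolding eq using r by (intro greedy_step.intros) auto
        have "card (U - row_set r) < card U"
          by (rule greedy_step_card_less[OF _ _ step]) (use finite_subset[OF U(2)] U(2) cov in simp_all)
        then show ?thesis using U(4,5) step by (auto intro: rtranclp.rtrancl_into_rtrancl)
      qed
      show ?thesis
        by (intro exI[of _ "U - row_set r"] exI[of _ ?\<rho>]) (use 1 2 U(2,3) r(1) in auto)
    qed
  qed
  from this[of "spine (left (enc_matrix M))"] obtain U \<rho> where
    U: "tgreedy (enc_matrix M) = enc_state n U \<rho>" "U \<subseteq> ?V"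
    "\<And>i. i < n \<Longrightarrow> i \<notin> U \<Longrightarrow> \<rho> i \<in> set M" "card U \<le> 0"
    "(greedy_step ?S)\<^sup>*\<^sup>* (?V, \<lambda>v. row_set (\<rho>\<^sub>0 v)) (U, \<lambda>v. row_set (\<rho> v))"
    unfolding tgreedy_def init len by auto
  then have "U = {}" using finite_subset by fastforce
  let ?R = "map \<rho> [0..<n]"
  have "tgreedy (enc_matrix M) = enc_list (\<lambda>i. enc_row (?R ! i)) [0..<length ?R]"
    unfolding U(1) enc_state_def \<open>U = {}\<close> by (auto intro!: enc_list_cong)
  also have "\<dots> = enc_list enc_row ?R" by (rule enc_list_conv_nth[symmetric])
  also have "\<dots> = enc_matrix ?R"
    unfolding enc_matrix_def by (rule enc_list_cong) (rule enc_row_def)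
  finally have "tgreedy (enc_matrix M) = enc_matrix ?R" .
  moreover have "greedy_cover ?V ?S (\<lambda>v. row_set (\<rho> v))"
    using U(5) unfolding \<open>U = {}\<close> greedy_cover_def by blast
  then have "greedy_cover ?V ?S (\<lambda>v. row_set (?R ! v))"
    by (rule greedy_cover_cong) simp
  then have "greedy_output n M ?R"
    using U(3) \<open>U = {}\<close> by (auto simp: greedy_output_def)
  ultimately show thesis using that by blast
qed

lemma greedy_polynomial_time: greedy_polynomial_time
proof -
  obtain c k where c: "\<And>s. \<exists>t s'. wexec c s t s' \<and> s' 0 = tgreedy (s 0) \<and> t \<le> (size (s 0) + 2) ^ k"
    using ptime_tgreedy unfolding ptime_def by blast
  let ?q = "[:2, 1:] ^ k :: nat poly"
  have "\<exists>t R. computes_in c (enc_matrix M) t (enc_matrix R) \<and>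
      t \<le> poly ?q (size (enc_matrix M)) \<and> greedy_output n M R" if M: "matrix_instance n M" for n M
  proof -
    obtain R where "tgreedy (enc_matrix M) = enc_matrix R" "greedy_output n M R"
      using tgreedy_correct[OF M] .
    then show ?thesis
      using c[of "(\<lambda>_. Leaf)(0 := enc_matrix M)"]
      by (auto simp: computes_in_def poly_power add.commute)
  qed
  then show ?thesis unfolding greedy_polynomial_time_def by blast
qed


section \<open>The approximation guarantee\<close>

text \<open>By the mean value theorem the difference is \<open>(p + 1) * z powr p\<close> for some
  \<open>z\<close> between \<open>x\<close> and \<open>x + 1\<close>.\<close>

lemma powr_diff_bounds:
  fixes p x :: real
  assumes "p > 0" "x \<ge> 0"
  shows "(p + 1) * x powr p \<le> (x + 1) powr (p + 1) - x powr (p + 1)"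
    and "(x + 1) powr (p + 1) - x powr (p + 1) \<le> (p + 1) * (x + 1) powr p"
proof -
  \<comment> \<open>Interior points are positive even for \<open>x = 0\<close>.\<close>
  have D: "((\<lambda>y. y powr (p + 1)) has_real_derivative (p + 1) * y powr p) (at y)" if "y > x" for y
    using has_real_derivative_powr[of y "p + 1"] that assms by simp
  have "continuous_on {x..x + 1} (\<lambda>y. y powr (p + 1))"
    using assms by (intro continuous_on_powr' continuous_intros) auto
  then obtain l z where z: "x < z" "z < x + 1" "((\<lambda>y. y powr (p + 1)) has_real_derivative l) (at z)"
    "(x + 1) powr (p + 1) - x powr (p + 1) = (x + 1 - x) * l"
    using MVT[of x "x + 1" "\<lambda>y. y powr (p + 1)"] D real_differentiable_def by fastforce
  then have mvt: "(x + 1) powr (p + 1) - x powr (p + 1) = (p + 1) * z powr p"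
    using DERIV_unique[OF z(3) D] by simp
  have "x powr p \<le> z powr p" "z powr p \<le> (x + 1) powr p"
    using z assms by (auto intro!: powr_mono2)
  then show "(p + 1) * x powr p \<le> (x + 1) powr (p + 1) - x powr (p + 1)"
    "(x + 1) powr (p + 1) - x powr (p + 1) \<le> (p + 1) * (x + 1) powr p"
    unfolding mvt using assms by (auto intro!: mult_left_mono)
qed

text \<open>Telescoping of the upper bound on the differences; the sum dominates the integral of the
  power function.\<close>

lemma sum_powr_ge:
  fixes p :: real
  assumes "p > 0"
  shows "real k powr (p + 1) \<le> (p + 1) * (\<Sum>i<k. real (Suc i) powr p)"
proof (induction k)
  case (Suc k)
  have "real (Suc k) powr (p + 1) \<le> real k powr (p + 1) + (p + 1) * real (Suc k) powr p"
    using powr_diff_bounds(2)[OF assms, of "real k"] by (simp add: add.commute)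
  then show ?case using Suc by (simp add: distrib_left)
qed simp

lemma sum_powr_le:
  fixes p :: real
  assumes "p > 0"
  shows "(p + 1) * (\<Sum>i<k. real i powr p) \<le> real k powr (p + 1)"
proof (induction k)
  case (Suc k)
  have "real k powr (p + 1) + (p + 1) * real k powr p \<le> real (Suc k) powr (p + 1)"
    using powr_diff_bounds(1)[OF assms, of "real k"] by (simp add: add.commute)
  then show ?case using Suc by (simp add: distrib_left)
qed simp

section \<open>Class sizes along a greedy run\<close>

lemma greedy_run_is_cover:
  assumes "(greedy_step S)\<^sup>*\<^sup>* (U, \<phi>) (U', \<phi>')"
  shows "\<forall>v\<in>U - U'. \<phi>' v \<in> S \<and> v \<in> \<phi>' v"
  using assms
proof (induction rule: rtranclp_induct2)
  case (step W \<chi> W' \<chi>')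
  from step.hyps(2) show ?case
    by cases (use step.IH in auto)
qed simp

lemma greedy_cover_is_cover: "greedy_cover V S \<phi> \<Longrightarrow> is_cover V S \<phi>"
  unfolding greedy_cover_def is_cover_def using greedy_run_is_cover by fastforce

text \<open>Steps reassign uncovered elements only, so the choice for an element is final once it is
  covered.\<close>

lemma greedy_run_unchanged:
  assumes "(greedy_step S)\<^sup>*\<^sup>* (U, \<phi>) (U', \<phi>')" "v \<notin> U"
  shows "\<phi>' v = \<phi> v"
proof -
  have "U' \<subseteq> U \<and> \<phi>' v = \<phi> v"
    using assms
  proof (induction rule: rtranclp_induct2)
    case (step W \<chi> W' \<chi>')
    from step.hyps(2) show ?case
      by cases (use step.IH[OF step.prems] step.prems in auto)
  qed simp
  then show ?thesis ..
qed

text \<open>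
  A set \<open>P\<close> with \<open>k\<close> uncovered elements was available to the algorithm, so the next set takes
  at least \<open>k\<close> elements. Hence the elements of \<open>P\<close> have class sizes at least \<open>k, k - 1, \<dots>, 1\<close>
  in the order in which they are covered.
\<close>

lemma greedy_run_sum_ge:
  fixes g :: "nat \<Rightarrow> real"
  assumes "(greedy_step S)\<^sup>*\<^sup>* (U, \<phi>) ({}, \<phi>')" "finite V" "U \<subseteq> V" "B \<in> S" "P \<subseteq> B" "mono g"
  shows "(\<Sum>i<card (P \<inter> U). g (Suc i)) \<le> (\<Sum>v\<in>P \<inter> U. g (class_size V \<phi>' v))"
  using assms(1,3)
proof (induction rule: converse_rtranclp_induct2)
  case (step U \<phi> U' \<psi>)
  have finU: "finite U" using step.prems assms(2) finite_subset by blast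
  from step.hyps(1) show ?case
  proof cases
    case (1 A)
    \<comment> \<open>The part of \<open>P\<close> taken by this step, and the part left for the
      induction hypothesis.\<close>
    let ?X = "P \<inter> U \<inter> A" and ?Y = "P \<inter> U'"
    have fin: "finite ?X" "finite ?Y" using finU 1 by auto
    have split: "P \<inter> U = ?X \<union> ?Y" "?X \<inter> ?Y = {}" using 1 by auto
    have card: "card (P \<inter> U) = card ?Y + card ?X"
      using card_Un_disjoint[OF fin split(2)] split(1) by simp
    have "g (card (P \<inter> U)) \<le> g (class_size V \<phi>' v)" if "v \<in> ?X" for v
    proof (rule monoD[OF assms(6)])
      have eq: "\<phi>' w = A" if "w \<in> A \<inter> U" for w
        using greedy_run_unchanged[OF step.hyps(2), of w] 1 that by auto
      have "card (P \<inter> U) \<le> card (B \<inter> U)" using assms(5) finU by (auto intro: card_mono)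
      also have "\<dots> \<le> card (A \<inter> U)" using 1 assms(4) by blast
      also have "\<dots> \<le> class_size V \<phi>' v"
        unfolding class_size_def using assms(2) step.prems eq that by (intro card_mono) auto
      finally show "card (P \<inter> U) \<le> class_size V \<phi>' v" .
    qed
    then have X: "real (card ?X) * g (card (P \<inter> U)) \<le> (\<Sum>v\<in>?X. g (class_size V \<phi>' v))"
      by (rule sum_bounded_below)
    \<comment> \<open>The largest \<open>card ?X\<close> indices are charged to \<open>?X\<close>,
      the others to \<open>?Y\<close>.\<close>
    have "(\<Sum>i<card (P \<inter> U). g (Suc i)) =
        (\<Sum>i<card ?Y. g (Suc i)) + (\<Sum>i=card ?Y..<card (P \<inter> U). g (Suc i))"
      unfolding lessThan_atLeast0 using card by (intro sum.atLeastLessThan_concat[symmetric]) auto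
    also have "(\<Sum>i=card ?Y..<card (P \<inter> U). g (Suc i)) \<le>
        real (card {card ?Y..<card (P \<inter> U)}) * g (card (P \<inter> U))"
      by (intro sum_bounded_above monoD[OF assms(6)]) auto
    also have "\<dots> \<le> (\<Sum>v\<in>?X. g (class_size V \<phi>' v))"
      using X card by simp
    also have "(\<Sum>i<card ?Y. g (Suc i)) \<le> (\<Sum>v\<in>?Y. g (class_size V \<phi>' v))"
      using step.IH step.prems 1 by auto
    also have "(\<Sum>v\<in>?Y. g (class_size V \<phi>' v)) + (\<Sum>v\<in>?X. g (class_size V \<phi>' v)) =
        (\<Sum>v\<in>P \<inter> U. g (class_size V \<phi>' v))"
      using sum.union_disjoint[OF fin split(2), of "\<lambda>v. g (class_size V \<phi>' v)"]
      unfolding split(1)[symmetric] by simp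
    finally show ?thesis by simp
  qed
qed simp

text \<open>The classes of \<open>\<psi>\<close> partition \<open>V\<close>, so it suffices to
  compare both sums on one class, which lies in a single member of \<open>S\<close>.\<close>

lemma greedy_sum_ge:
  fixes p :: real
  assumes p: "p > 0" and inst: "set_cover_instance V S"
    and greedy: "greedy_cover V S \<phi>" and cover: "is_cover V S \<psi>"
  shows "(\<Sum>v\<in>V. real (class_size V \<psi> v) powr p) \<le>
    (p + 1) * (\<Sum>v\<in>V. real (class_size V \<phi> v) powr p)"
proof -
  have fin: "finite V" using inst by (simp add: set_cover_instance_def)
  obtain \<phi>\<^sub>0 where run: "(greedy_step S)\<^sup>*\<^sup>* (V, \<phi>\<^sub>0) ({}, \<phi>)"
    using greedy by (auto simp: greedy_cover_def)
  have class_le: "(\<Sum>v\<in>{v\<in>V. \<psi> v = B}. real (class_size V \<psi> v) powr p) \<le>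
      (p + 1) * (\<Sum>v\<in>{v\<in>V. \<psi> v = B}. real (class_size V \<phi> v) powr p)" if "B \<in> \<psi> ` V" for B
  proof -
    let ?P = "{v\<in>V. \<psi> v = B}"
    have "(\<Sum>v\<in>?P. real (class_size V \<psi> v) powr p) = (\<Sum>v\<in>?P. real (card ?P) powr p)"
      by (intro sum.cong) (auto simp: class_size_def)
    also have "\<dots> = real (card ?P) powr (p + 1)"
      by (cases "card ?P = 0") (auto simp: powr_add)
    also have "\<dots> \<le> (p + 1) * (\<Sum>i<card ?P. real (Suc i) powr p)"
      by (rule sum_powr_ge[OF p])
    also have "(\<Sum>i<card ?P. real (Suc i) powr p) \<le> (\<Sum>v\<in>?P. real (class_size V \<phi> v) powr p)"
    proof -
      have "mono (\<lambda>i. real i powr p)" using p by (auto intro!: monoI powr_mono2)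
      moreover have "?P \<subseteq> B" "B \<in> S" using cover that by (auto simp: is_cover_def)
      moreover have "?P \<inter> V = ?P" by auto
      ultimately show ?thesis
        using greedy_run_sum_ge[OF run fin subset_refl, of B ?P "\<lambda>i. real i powr p"] by simp
    qed
    finally show ?thesis using p by simp
  qed
  have "(\<Sum>v\<in>V. real (class_size V \<psi> v) powr p) =
      (\<Sum>B\<in>\<psi> ` V. \<Sum>v\<in>{v\<in>V. \<psi> v = B}. real (class_size V \<psi> v) powr p)"
    by (rule sum.image_gen[OF fin])
  also have "\<dots> \<le> (\<Sum>B\<in>\<psi> ` V. (p + 1) * (\<Sum>v\<in>{v\<in>V. \<psi> v = B}. real (class_size V \<phi> v) powr p))"
    by (rule sum_mono[OF class_le])
  also have "\<dots> = (p + 1) * (\<Sum>v\<in>V. real (class_size V \<phi> v) powr p)"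
    unfolding sum_distrib_left[symmetric] by (subst sum.image_gen[OF fin, of _ \<psi>]) simp
  finally show ?thesis .
qed

text \<open>The value depends only on the restriction to \<open>V\<close>, and there are finitely
  many maps from \<open>V\<close> to \<open>S\<close>. This makes \<open>Max\<close> in
  \<open>opt_value\<close> meaningful.\<close>

lemma finite_cover_values:
  assumes "set_cover_instance V S"
  shows "finite {cover_value p V \<phi> |\<phi>. is_cover V S \<phi>}"
proof -
  have fin: "finite V" "finite S"
    using assms by (auto simp: set_cover_instance_def intro: finite_UnionD)
  have "cover_value p V \<phi> = cover_value p V (restrict \<phi> V)" for \<phi>
    unfolding cover_value_def gen_mean_def class_size_def restrict_def
    by (intro arg_cong[where f = "\<lambda>x. (1 / real (card V) * x) powr (1 / p)"] sum.cong
        arg_cong[where f = "\<lambda>A. real (card A) powr p"]) auto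
  then have "{cover_value p V \<phi> |\<phi>. is_cover V S \<phi>} \<subseteq> cover_value p V ` (V \<rightarrow>\<^sub>E S)"
    by (fastforce simp: is_cover_def intro: image_eqI[where x = "restrict _ V"])
  then show ?thesis by (rule finite_subset) (intro finite_imageI finite_PiE fin)
qed

lemma cover_value_le_opt:
  "set_cover_instance V S \<Longrightarrow> is_cover V S \<psi> \<Longrightarrow> cover_value p V \<psi> \<le> opt_value p V S"
  unfolding opt_value_def by (rule Max_ge[OF finite_cover_values]) auto

lemma greedy_approximation:
  fixes p :: real
  assumes p: "p > 0" and inst: "set_cover_instance V S" and greedy: "greedy_cover V S \<phi>"
  shows "opt_value p V S / (p + 1) powr (1 / p) \<le> cover_value p V \<phi>"
proof -
  have "cover_value p V \<psi> \<le> (p + 1) powr (1 / p) * cover_value p V \<phi>" if "is_cover V S \<psi>" for \<psi>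
  proof -
    have "1 / real (card V) * (\<Sum>v\<in>V. real (class_size V \<psi> v) powr p) \<le>
        (p + 1) * (1 / real (card V) * (\<Sum>v\<in>V. real (class_size V \<phi> v) powr p))"
      using mult_left_mono[OF greedy_sum_ge[OF p inst greedy that], of "1 / real (card V)"]
      by (simp add: mult.left_commute)
    then have "cover_value p V \<psi> \<le>
        ((p + 1) * (1 / real (card V) * (\<Sum>v\<in>V. real (class_size V \<phi> v) powr p))) powr (1 / p)"
      unfolding cover_value_def gen_mean_def using p
      by (intro powr_mono2 mult_nonneg_nonneg sum_nonneg) auto
    also have "\<dots> = (p + 1) powr (1 / p) * cover_value p V \<phi>"
      unfolding cover_value_def gen_mean_def by (rule powr_mult)
    finally show ?thesis .
  qed
  moreover have "{cover_value p V \<psi> |\<psi>. is_cover V S \<psi>} \<noteq> {}"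
    using greedy_cover_is_cover[OF greedy] by blast
  ultimately have "opt_value p V S \<le> (p + 1) powr (1 / p) * cover_value p V \<phi>"
    unfolding opt_value_def using finite_cover_values[OF inst] by (subst Max_le_iff) auto
  then show ?thesis using p by (simp add: field_simps)
qed


section \<open>Tightness\<close>

text \<open>
  Row \<open>r\<close> of the grid \<open>{..<k} \<times> {..<m}\<close> consists of the numbers \<open>v\<close> with \<open>v div m = r\<close> and is
  split into blocks of size \<open>r + 2\<close>. While \<open>r\<close> is the last row that is not fully covered, a
  column contains at most \<open>r + 1\<close> uncovered elements, so the greedy algorithm never picks a
  column and there are no harmful ties.
\<close>

definition block :: "nat \<Rightarrow> nat \<Rightarrow> nat set" where
  "block m v = {w. w div (v div m + 2) = v div (v div m + 2)}"

definition column :: "nat \<Rightarrow> nat \<Rightarrow> nat \<Rightarrow> nat set" where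
  "column k m v = {w. w < k * m \<and> w mod m = v mod m}"

definition grid_sets :: "nat \<Rightarrow> nat \<Rightarrow> nat set set" where
  "grid_sets k m = block m ` {..<k * m} \<union> column k m ` {..<k * m}"

lemma card_quotient_class:
  assumes "b > 0"
  shows "card {w :: nat. w div b = q} = b"
proof -
  have "w div b = q \<longleftrightarrow> w \<in> {q * b..<q * b + b}" for w
    using less_eq_div_iff_mult_less_eq[OF assms, of q w] div_less_iff_less_mult[OF assms, of w "q + 1"]
    by (simp add: algebra_simps) linarith
  then have "{w. w div b = q} = {q * b..<q * b + b}" by blast
  then show ?thesis by simp
qed

text \<open>By divisibility, blocks of size \<open>r + 2\<close> fill row \<open>r\<close> exactly,
  without crossing into another row.\<close>

locale grid =
  fixes k m :: nat
  assumes m: "m > 0" and dvd: "\<And>r. r < k \<Longrightarrow> r + 2 dvd m"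
begin

lemma row_less: "v < k * m \<Longrightarrow> v div m < k"
  by (simp add: less_mult_imp_div_less)

lemma row_block:
  assumes "v < k * m" "w \<in> block m v"
  shows "w div m = v div m"
proof -
  obtain c where c: "m = (v div m + 2) * c" using dvd[OF row_less[OF assms(1)]] by (elim dvdE)
  \<comment> \<open>Division by \<open>m\<close> is division by the block size followed by division
    by \<open>c\<close>, so the block determines the row.\<close>
  have "w div ((v div m + 2) * c) = v div ((v div m + 2) * c)"
    using assms(2) unfolding div_mult2_eq block_def by simp
  then show ?thesis using c by metis
qed

lemma block_self: "v \<in> block m v"
  by (simp add: block_def)

lemma block_eq: "v < k * m \<Longrightarrow> w \<in> block m v \<Longrightarrow> block m w = block m v"
  using row_block[of v w] by (auto simp: block_def)

lemma block_subset:
  assumes "v < k * m"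
  shows "block m v \<subseteq> {..<k * m}"
proof
  fix w assume "w \<in> block m v"
  then have "w div m < k" using row_block[OF assms] row_less[OF assms] by simp
  then show "w \<in> {..<k * m}" using div_less_iff_less_mult[OF m] by simp
qed

lemma card_block: "card (block m v) = v div m + 2"
  unfolding block_def by (rule card_quotient_class) simp

lemma inj_on_row_column: "inj_on (\<lambda>w. w div m) (column k m v)"
proof (rule inj_onI)
  fix x y assume "x \<in> column k m v" "y \<in> column k m v" "x div m = y div m"
  then show "x = y" using div_mult_mod_eq[of x m] div_mult_mod_eq[of y m]
    by (simp add: column_def)
qed

lemma card_column_le:
  assumes "\<And>w. w \<in> U \<Longrightarrow> w div m \<le> r"
  shows "card (column k m v \<inter> U) \<le> r + 1"
proof -
  have "inj_on (\<lambda>w. w div m) (column k m v \<inter> U)"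
    by (rule inj_on_subset[OF inj_on_row_column[of v]]) auto
  then have "card (column k m v \<inter> U) \<le> card {..r}"
    by (rule card_inj_on_le) (use assms in auto)
  then show ?thesis by simp
qed

lemma row_image_column: "v < k * m \<Longrightarrow> (\<lambda>w. w div m) ` column k m v = {..<k}"
proof (intro equalityI subsetI)
  fix r assume "r \<in> {..<k}"
  then have "(r * m + v mod m) div m = r" "(r * m + v mod m) mod m = v mod m"
    using m by auto
  moreover have "r * m + v mod m < k * m"
    using \<open>r \<in> {..<k}\<close> calculation(1) div_less_iff_less_mult[OF m] by (metis lessThan_iff)
  ultimately show "r \<in> (\<lambda>w. w div m) ` column k m v"
    unfolding column_def by (intro image_eqI[of _ _ "r * m + v mod m"]) auto
qed (auto simp: column_def row_less)

lemma card_column: "v < k * m \<Longrightarrow> card (column k m v) = k"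
  using card_image[OF inj_on_row_column, of v] row_image_column by simp

lemma grid_instance: "set_cover_instance {..<k * m} (grid_sets k m)"
  using block_subset block_self
  unfolding set_cover_instance_def grid_sets_def by (fastforce simp: column_def)

text \<open>The uncovered set is a union of blocks. A block in its last row \<open>r\<close> gains
  \<open>r + 2\<close>, more than any column and any block of an earlier row.\<close>

lemma greedy_picks_block:
  assumes U: "U \<subseteq> {..<k * m}" "\<And>v. v \<in> U \<Longrightarrow> block m v \<subseteq> U"
    and step: "greedy_step (grid_sets k m) (U, \<phi>) (U', \<phi>')"
  obtains v where "v \<in> U" "\<And>w. w \<in> U \<Longrightarrow> w div m \<le> v div m"
    "U' = U - block m v" "\<phi>' = (\<lambda>w. if w \<in> block m v then block m v else \<phi> w)"
  using step
proof cases
  case (1 A)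
  have fin: "finite U" using U(1) finite_subset by blast
  define r where "r = Max ((\<lambda>w. w div m) ` U)"
  have le: "w div m \<le> r" if "w \<in> U" for w
    using that fin unfolding r_def by simp
  have "r \<in> (\<lambda>w. w div m) ` U"
    unfolding r_def using fin 1 by (intro Max_in) auto
  then obtain u where u: "u \<in> U" "u div m = r" by blast
  have "r + 2 = card (block m u \<inter> U)"
    using U(2)[OF u(1)] u(2) card_block[of u] by (simp add: Int_absorb2)
  also have "\<dots> \<le> card (A \<inter> U)"
    using 1 u(1) U(1) by (auto simp: grid_sets_def)
  finally have A: "r + 2 \<le> card (A \<inter> U)" .
  have "card (column k m x \<inter> U) \<le> r + 1" for x
    by (rule card_column_le[OF le])
  then have "A \<notin> column k m ` {..<k * m}"
    using A by (metis Suc_eq_plus1 add_2_eq_Suc' imageE not_less_eq_eq order_trans)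
  then obtain a where a: "a < k * m" "A = block m a"
    using 1 by (auto simp: grid_sets_def)
  \<comment> \<open>Naming the block by an uncovered element \<open>v\<close> shows that it lies
    entirely in \<open>U\<close>.\<close>
  have "A \<inter> U \<noteq> {}" using A by auto
  then obtain v where v: "v \<in> A" "v \<in> U" by blast
  then have Av: "A = block m v" using a block_eq by simp
  have "card (A \<inter> U) \<le> v div m + 2"
    using card_block[of v] U(2)[OF v(2)] by (simp add: Av Int_absorb2)
  then have "w div m \<le> v div m" if "w \<in> U" for w
    using A le[OF that] by linarith
  moreover have "block m v \<inter> U = block m v" using U(2)[OF v(2)] by auto
  then have "\<phi>' = (\<lambda>w. if w \<in> block m v then block m v else \<phi> w)"
    using 1 by (simp only: Av)
  ultimately show thesis using that[OF v(2)] 1 Av by simp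
qed

text \<open>Distinct blocks are disjoint, so removing one keeps the uncovered set a union of
  blocks.\<close>

lemma greedy_run_invariant:
  assumes "(greedy_step (grid_sets k m))\<^sup>*\<^sup>* ({..<k * m}, \<phi>) (U, \<phi>')"
  shows "U \<subseteq> {..<k * m} \<and> (\<forall>v\<in>U. block m v \<subseteq> U) \<and> (\<forall>v<k * m. v \<notin> U \<longrightarrow> \<phi>' v = block m v)"
  using assms
proof (induction rule: rtranclp_induct2)
  case refl
  show ?case using block_subset by auto
next
  case (step U \<chi> U' \<chi>')
  obtain v where v: "v \<in> U" "U' = U - block m v"
    "\<chi>' = (\<lambda>w. if w \<in> block m v then block m v else \<chi> w)"
    using greedy_picks_block[of U \<chi> U' \<chi>'] step by metis
  have "v < k * m" using v step.IH by auto
  then have "block m w \<inter> block m v = {}" if "w < k * m" "w \<notin> block m v" for w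
    using that block_eq block_self by blast
  then have "block m w \<subseteq> U'" if "w \<in> U'" for w
    using that v(2) step.IH by blast
  moreover have "\<chi>' w = block m w" if "w < k * m" "w \<notin> U'" for w
    using that v(2,3) step.IH block_eq[OF \<open>v < k * m\<close>, of w] by auto
  ultimately show ?case using step.IH v(2) by auto
qed

lemma class_size_greedy:
  assumes "greedy_cover {..<k * m} (grid_sets k m) \<phi>" "v < k * m"
  shows "class_size {..<k * m} \<phi> v = v div m + 2"
proof -
  obtain \<phi>\<^sub>0 where "(greedy_step (grid_sets k m))\<^sup>*\<^sup>* ({..<k * m}, \<phi>\<^sub>0) ({}, \<phi>)"
    using assms(1) by (auto simp: greedy_cover_def)
  from greedy_run_invariant[OF this] have \<phi>: "\<phi> w = block m w" if "w < k * m" for w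
    using that by blast
  have "w < k * m \<and> \<phi> w = \<phi> v \<longleftrightarrow> w \<in> block m v" for w
    using \<phi> assms(2) block_subset[OF assms(2)] block_eq[OF assms(2), of w] block_self[of w]
    by (metis lessThan_iff subsetD)
  then have "{w \<in> {..<k * m}. \<phi> w = \<phi> v} = block m v" by auto
  then show ?thesis by (simp add: class_size_def card_block)
qed

lemma column_cover: "is_cover {..<k * m} (grid_sets k m) (column k m)"
  by (auto simp: is_cover_def grid_sets_def column_def)

lemma class_size_column:
  assumes "v < k * m"
  shows "class_size {..<k * m} (column k m) v = k"
proof -
  have "{w \<in> {..<k * m}. column k m w = column k m v} = column k m v"
    using assms by (auto simp: column_def)
  then show ?thesis by (simp add: class_size_def card_column[OF assms])
qed

text \<open>The mean of the greedy \<open>p\<close>-th powers is the sum of \<open>j powr p\<close>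
  for \<open>j\<close> from \<open>2\<close> to \<open>k + 1\<close>, divided by \<open>k\<close>.
  It is at most \<open>(k + 2) powr (p + 1) / ((p + 1) * k)\<close>, while the columns achieve
  \<open>k powr p\<close>.\<close>

lemma ratio_ge:
  fixes p :: real
  assumes p: "p > 0" and k: "k > 0" and greedy: "greedy_cover {..<k * m} (grid_sets k m) \<phi>"
  shows "cover_value p {..<k * m} \<phi> > 0"
    and "((p + 1) * (real k / real (k + 2)) powr (p + 1)) powr (1 / p) * cover_value p {..<k * m} \<phi>
      \<le> opt_value p {..<k * m} (grid_sets k m)"
proof -
  let ?V = "{..<k * m}" and ?s = "\<Sum>r<k. real (r + 2) powr p"
  have n: "real (card ?V) = real k * real m" by simp
  have "(\<Sum>v\<in>?V. real (class_size ?V \<phi> v) powr p) = (\<Sum>v\<in>?V. real (v div m + 2) powr p)"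
    using class_size_greedy[OF greedy] by simp
  \<comment> \<open>Group the elements by rows.\<close>
  also have "\<dots> = (\<Sum>r<k. \<Sum>v=r * m..<r * m + m. real (v div m + 2) powr p)"
    by (rule sum.nat_group[symmetric])
  also have "\<dots> = (\<Sum>r<k. \<Sum>v=r * m..<r * m + m. real (r + 2) powr p)"
  proof (intro sum.cong refl)
    fix r v assume "v \<in> {r * m..<r * m + m}"
    then have "v div m = r" by (intro div_nat_eqI) (auto simp: mult.commute)
    then show "real (v div m + 2) powr p = real (r + 2) powr p" by simp
  qed
  also have "\<dots> = real m * ?s" by (simp add: sum_distrib_left)
  finally have val: "cover_value p ?V \<phi> = (?s / real k) powr (1 / p)"
    unfolding cover_value_def gen_mean_def n using m by simp
  have pos: "?s > 0" using k by (intro sum_pos) auto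
  then show "cover_value p ?V \<phi> > 0" unfolding val using k by simp
  have "(p + 1) * ?s \<le> (p + 1) * (\<Sum>i<k + 2. real i powr p)"
  proof -
    have "?s = (\<Sum>i=2..<k + 2. real i powr p)"
      unfolding lessThan_atLeast0
      using sum.shift_bounds_nat_ivl[of "\<lambda>i. real i powr p" 0 2 k] by (simp only: add_0)
    also have "\<dots> \<le> (\<Sum>i<k + 2. real i powr p)" by (intro sum_mono2) auto
    finally show ?thesis using p by simp
  qed
  also have "\<dots> \<le> real (k + 2) powr (p + 1)" by (rule sum_powr_le[OF p])
  finally have "(p + 1) * ?s * (real k / real (k + 2)) powr (p + 1) \<le>
      real (k + 2) powr (p + 1) * (real k / real (k + 2)) powr (p + 1)"
    by (rule mult_right_mono) simp
  also have "\<dots> = real k powr (p + 1)" by (simp flip: powr_mult)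
  finally have "(p + 1) * ?s * (real k / real (k + 2)) powr (p + 1) \<le> real k powr (p + 1)" .
  then have "(p + 1) * ?s * (real k / real (k + 2)) powr (p + 1) / real k \<le> real k powr (p + 1) / real k"
    by (rule divide_right_mono) simp
  also have "\<dots> = real k powr p" using k by (simp add: powr_add)
  finally have le: "(p + 1) * (real k / real (k + 2)) powr (p + 1) * (?s / real k) \<le> real k powr p"
    by (simp add: mult_ac)
  have "((p + 1) * (real k / real (k + 2)) powr (p + 1)) powr (1 / p) * cover_value p ?V \<phi> =
      ((p + 1) * (real k / real (k + 2)) powr (p + 1) * (?s / real k)) powr (1 / p)"
    unfolding val by (rule powr_mult[symmetric])
  also have "\<dots> \<le> (real k powr p) powr (1 / p)"
    using p pos by (intro powr_mono2 le) auto
  also have "\<dots> = cover_value p ?V (column k m)"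
    unfolding cover_value_def gen_mean_def using class_size_column m k by simp
  also have "\<dots> \<le> opt_value p ?V (grid_sets k m)"
    by (rule cover_value_le_opt[OF grid_instance column_cover])
  finally show "((p + 1) * (real k / real (k + 2)) powr (p + 1)) powr (1 / p) * cover_value p ?V \<phi>
      \<le> opt_value p ?V (grid_sets k m)" .
qed

end

text \<open>The lower bound of \<open>ratio_ge\<close> tends to \<open>(p + 1) powr (1 / p)\<close>
  as \<open>k\<close> grows, and the guarantee is the matching upper bound.\<close>

lemma greedy_tight:
  fixes p :: real
  assumes p: "p > 0" and "\<epsilon> > 0"
  shows "\<exists>(V :: nat set) S. set_cover_instance V S \<and> (\<exists>\<phi>. greedy_cover V S \<phi>) \<and>
    (\<forall>\<phi>. greedy_cover V S \<phi> \<longrightarrow> \<bar>opt_value p V S / cover_value p V \<phi> - (p + 1) powr (1 / p)\<bar> < \<epsilon>)"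
proof -
  let ?L = "(p + 1) powr (1 / p)"
  let ?f = "\<lambda>k. ((p + 1) * (real k / real (k + 2)) powr (p + 1)) powr (1 / p)"
  have "(\<lambda>k. real k / real (k + 2)) \<longlonglongrightarrow> 1"
  proof -
    have "(\<lambda>k. 1 - 2 * inverse (real (Suc (Suc k)))) \<longlonglongrightarrow> 1 - 2 * 0"
      by (intro tendsto_intros LIMSEQ_Suc[OF LIMSEQ_inverse_real_of_nat])
    then show ?thesis by (simp add: field_simps)
  qed
  then have "?f \<longlonglongrightarrow> ((p + 1) * 1 powr (p + 1)) powr (1 / p)"
    using p by (intro tendsto_intros) auto
  then have "\<forall>\<^sub>F k in sequentially. ?f k > ?L - \<epsilon>"
    using order_tendstoD(1)[of ?f ?L sequentially "?L - \<epsilon>"] \<open>\<epsilon> > 0\<close> by simp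
  then have "\<forall>\<^sub>F k in sequentially. ?f k > ?L - \<epsilon> \<and> k > 0"
    using eventually_gt_at_top by (rule eventually_conj)
  then obtain k where k: "?f k > ?L - \<epsilon>" "k > 0"
    by (auto dest: eventually_happens)
  \<comment> \<open>The block sizes are \<open>2, ..., k + 1\<close>, and all of them divide
    \<open>fact (k + 1)\<close>.\<close>
  interpret grid k "fact (k + 1)"
  proof
    show "fact (k + 1) > (0 :: nat)" by (rule fact_gt_zero)
    show "r + 2 dvd fact (k + 1)" if "r < k" for r
      using that by (intro dvd_fact) auto
  qed
  let ?V = "{..<k * fact (k + 1)}" and ?S = "grid_sets k (fact (k + 1))"
  have "\<bar>opt_value p ?V ?S / cover_value p ?V \<phi> - ?L\<bar> < \<epsilon>" if "greedy_cover ?V ?S \<phi>" for \<phi>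
  proof -
    note ratio = ratio_ge[OF p k(2) that]
    have "?f k \<le> opt_value p ?V ?S / cover_value p ?V \<phi>"
      using ratio by (simp add: pos_le_divide_eq)
    moreover have "opt_value p ?V ?S / cover_value p ?V \<phi> \<le> ?L"
      using greedy_approximation[OF p grid_instance that] ratio(1) p by (simp add: field_simps)
    ultimately show ?thesis using k(1) \<open>\<epsilon> > 0\<close> by linarith
  qed
  then show ?thesis using grid_instance greedy_cover_exists[OF grid_instance] by blast
qed

theorem theorem1:
  fixes p :: real
  assumes "p > 0"
  shows "greedy_polynomial_time
    \<and> (\<forall>(V :: 'a set) S \<phi>. set_cover_instance V S \<and> greedy_cover V S \<phi> \<longrightarrow>
         is_cover V S \<phi> \<and> cover_value p V \<phi> \<ge> opt_value p V S / (p + 1) powr (1 / p))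
    \<and> (\<forall>\<epsilon>>0. \<exists>(V :: nat set) S. set_cover_instance V S \<and> (\<exists>\<phi>. greedy_cover V S \<phi>) \<and>
         (\<forall>\<phi>. greedy_cover V S \<phi> \<longrightarrow>
            \<bar>opt_value p V S / cover_value p V \<phi> - (p + 1) powr (1 / p)\<bar> < \<epsilon>))"
  using greedy_polynomial_time greedy_cover_is_cover greedy_approximation[OF assms]
    greedy_tight[OF assms] by blast

end
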